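(* Let $T$ be a completely nonunitary contraction with rank one defects on a separable Hilbert space $H$. Then there exists a probability measure $\mu$ on $\mathbb{T}$ such that $T$ is unitarily equivalent to the operator $\mathcal{K}\ni h\mapsto P_{\mathcal{K}}\bigl(\zeta h(\zeta)\bigr)$ acting on $\mathcal{K}:=L^2(\mathbb{T},d\mu)\ominus\mathbb{C}$ (the orthogonal complement of the constant functions), where $P_{\mathcal{K}}$ is the orthogonal projection in $L^2(\mathbb{T},d\mu)$ onto $\mathcal{K}$. Moreover, the Schur function associated with $\mu$ is the characteristic function of $T$ (under an identification of the one-dimensional defect subspaces of $T$ with $\mathbb{C}$ by unitary maps).
   Context: $\mathbb{D}$ is the open unit disk, $\mathbb{T}$ the unit circle; Hilbert spaces are complex. For a contraction $T$ ($\|T\|\le1$) on $H$, put $D_T=(I-T^*T)^{1/2}$, $D_{T^*}=(I-TT^* )^{1/2}$, $\mathfrak{D}_T=\overline{\mathrm{ran}}\,D_T$, $\mathfrak{D}_{T^*}=\overline{\mathrm{ran}}\,D_{T^*}$. $T$ has rank one defects if $\dim\mathfrak{D}_T=\dim\mathfrak{D}_{T^*}=1$. $T$ is completely nonunitary if there is no nonzero subspace reducing $T$ on which $T$ is unitary. The (Sz.-Nagy--Foias) characteristic function of $T$ is $$\Theta_T(z)=\bigl(-T+zD_{T^*}(I-zT^* )^{-1}D_T\bigr)|_{\mathfrak{D}_T}:\mathfrak{D}_T\to\mathfrak{D}_{T^*},\quad z\in\mathbb{D}.$$ For a contraction with rank one defects, identifying the one-dimensional spaces $\mathfrak{D}_T,\mathfrak{D}_{T^*}$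 with $\mathbb{C}$ by unitary maps turns $\Theta_T$ into a scalar function, determined up to a unimodular constant factor. For a probability measure $\mu$ on $\mathbb{T}$ let $F(z)=\int_{\mathbb{T}}\frac{\zeta+z}{\zeta-z}\,d\mu(\zeta)$, $z\in\mathbb{D}$. The Schur function associated with $\mu$ is $f(z)=\frac1z\,\frac{F(z)-1}{F(z)+1}$; it is analytic in $\mathbb{D}$ with $|f|\le1$. *)

theory Defs
  imports "HOL-Probability.Probability"
begin

text \<open>The inner product \<open>cinner\<close> is linear in its first argument. Building on the class
  \<open>real_inner\<close> costs no generality: every complex inner product space is a real one under
  \<open>Re \<langle>x, y\<rangle>\<close>, with the same norm.\<close>

class complex_inner = real_inner +
  fixes scaleC :: "complex \<Rightarrow> 'a \<Rightarrow> 'a" (infixr \<open>*\<^sub>C\<close> 75)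
    and cinner :: "'a \<Rightarrow> 'a \<Rightarrow> complex"
  assumes scaleC_add_right: "a *\<^sub>C (x + y) = a *\<^sub>C x + a *\<^sub>C y"
    and scaleC_add_left: "(a + b) *\<^sub>C x = a *\<^sub>C x + b *\<^sub>C x"
    and scaleC_scaleC: "a *\<^sub>C (b *\<^sub>C x) = (a * b) *\<^sub>C x"
    and scaleC_one: "1 *\<^sub>C x = x"
    and scaleR_eq_scaleC: "r *\<^sub>R x = complex_of_real r *\<^sub>C x"
    and cinner_commute: "cinner x y = cnj (cinner y x)"
    and cinner_add_left: "cinner (x + y) z = cinner x z + cinner y z"
    and cinner_scaleC_left: "cinner (a *\<^sub>C x) y = a * cinner x y"
    and inner_eq_Re_cinner: "inner x y = Re (cinner x y)"

class chilbert_space = complex_inner + complete_space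

instantiation complex :: chilbert_space
begin

definition scaleC_complex :: "complex \<Rightarrow> complex \<Rightarrow> complex"
  where "scaleC_complex a x = a * x"

definition cinner_complex :: "complex \<Rightarrow> complex \<Rightarrow> complex"
  where "cinner_complex x y = x * cnj y"

instance
  by standard
    (auto simp: scaleC_complex_def cinner_complex_def algebra_simps scaleR_conv_of_real
      inner_complex_def)

end

global_interpretation complex_vector:
  vector_space "scaleC :: complex \<Rightarrow> 'a \<Rightarrow> 'a::complex_inner"
  by unfold_locales (auto simp: scaleC_add_right scaleC_add_left scaleC_scaleC scaleC_one)

definition bounded_clinear :: "('a::complex_inner \<Rightarrow> 'b::complex_inner) \<Rightarrow> bool"
  where "bounded_clinear T \<longleftrightarrow>
    Vector_Spaces.linear scaleC scaleC T \<and> bounded_linear T"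

definition contraction :: "('a::chilbert_space \<Rightarrow> 'a) \<Rightarrow> bool"
  where "contraction T \<longleftrightarrow> bounded_clinear T \<and> onorm T \<le> 1"

definition cadjoint :: "('a::chilbert_space \<Rightarrow> 'a) \<Rightarrow> 'a \<Rightarrow> 'a"
  where "cadjoint T = (THE S. \<forall>x y. cinner (T x) y = cinner x (S y))"

definition positive_op :: "('a::chilbert_space \<Rightarrow> 'a) \<Rightarrow> bool"
  where "positive_op A \<longleftrightarrow> bounded_clinear A \<and> (\<forall>x. cinner (A x) x \<in> \<real>\<^sub>\<ge>\<^sub>0)"

definition op_sqrt :: "('a::chilbert_space \<Rightarrow> 'a) \<Rightarrow> 'a \<Rightarrow> 'a"
  where "op_sqrt A = (THE S. positive_op S \<and> S \<circ> S = A)"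

definition unitary_between ::
    "'a::complex_inner set \<Rightarrow> 'b::complex_inner set \<Rightarrow> ('a \<Rightarrow> 'b) \<Rightarrow> bool"
  where "unitary_between M N U \<longleftrightarrow>
    (\<forall>x\<in>M. \<forall>y\<in>M. U (x + y) = U x + U y) \<and>
    (\<forall>c. \<forall>x\<in>M. U (c *\<^sub>C x) = c *\<^sub>C U x) \<and>
    (\<forall>x\<in>M. \<forall>y\<in>M. cinner (U x) (U y) = cinner x y) \<and>
    U ` M = N"

definition reduces :: "'a::chilbert_space set \<Rightarrow> ('a \<Rightarrow> 'a) \<Rightarrow> bool"
  where "reduces M T \<longleftrightarrow> complex_vector.subspace M \<and> closed M \<and>
    T ` M \<subseteq> M \<and> cadjoint T ` M \<subseteq> M"

definition completely_nonunitary :: "('a::chilbert_space \<Rightarrow> 'a) \<Rightarrow> bool"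
  where "completely_nonunitary T \<longleftrightarrow>
    \<not> (\<exists>M. M \<noteq> {0} \<and> reduces M T \<and> unitary_between M M T)"

text \<open>Since \<open>T\<^sup>*\<^sup>* = T\<close>, the operator \<open>(I - T T\<^sup>*)\<^sup>1\<^sup>/\<^sup>2\<close> is \<open>defect_op (cadjoint T)\<close>.\<close>

definition defect_op :: "('a::chilbert_space \<Rightarrow> 'a) \<Rightarrow> 'a \<Rightarrow> 'a"
  where "defect_op T = op_sqrt (\<lambda>x. x - cadjoint T (T x))"

definition defect_space :: "('a::chilbert_space \<Rightarrow> 'a) \<Rightarrow> 'a set"
  where "defect_space T = closure (range (defect_op T))"

definition rank_one_defects :: "('a::chilbert_space \<Rightarrow> 'a) \<Rightarrow> bool"
  where "rank_one_defects T \<longleftrightarrow>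
    complex_vector.dim (defect_space T) = 1 \<and>
    complex_vector.dim (defect_space (cadjoint T)) = 1"

definition char_fun :: "('a::chilbert_space \<Rightarrow> 'a) \<Rightarrow> complex \<Rightarrow> 'a \<Rightarrow> 'a"
  where "char_fun T z = (\<lambda>x\<in>defect_space T.
    - T x + z *\<^sub>C defect_op (cadjoint T)
      (inv (\<lambda>y. y - z *\<^sub>C cadjoint T y) (defect_op T x)))"

text \<open>The scalar function \<open>f\<close> on the disk is \<open>v \<circ> \<Theta>\<^sub>T(z) \<circ> u\<^sup>-\<^sup>1\<close>, where \<open>u\<close> and \<open>v\<close> are
  unitary maps from the two defect spaces onto \<open>\<complex>\<close>.\<close>

definition is_scalar_char_fun :: "('a::chilbert_space \<Rightarrow> 'a) \<Rightarrow> (complex \<Rightarrow> complex) \<Rightarrow> bool"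
  where "is_scalar_char_fun T f \<longleftrightarrow>
    (\<exists>u v. unitary_between (defect_space T) (UNIV :: complex set) u \<and>
           unitary_between (defect_space (cadjoint T)) (UNIV :: complex set) v \<and>
           (\<forall>z\<in>ball 0 1. \<forall>x\<in>defect_space T. v (char_fun T z x) = f z * u x))"

definition circle_prob_measure :: "complex measure \<Rightarrow> bool"
  where "circle_prob_measure \<mu> \<longleftrightarrow>
    prob_space \<mu> \<and> sets \<mu> = sets (restrict_space borel (sphere 0 1))"

definition herglotz :: "complex measure \<Rightarrow> complex \<Rightarrow> complex"
  where "herglotz \<mu> z = (\<integral>\<zeta>. (\<zeta> + z) / (\<zeta> - z) \<partial>\<mu>)"

definition schur_quotient :: "complex measure \<Rightarrow> complex \<Rightarrow> complex"
  where "schur_quotient \<mu> z = 1 / z * ((herglotz \<mu> z - 1) / (herglotz \<mu> z + 1))"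

text \<open>The singularity at \<open>0\<close> is removable (\<open>herglotz \<mu> 0 = 1\<close>); as division by zero is
  zero in HOL, the value there has to be given separately.\<close>

definition schur_function :: "complex measure \<Rightarrow> complex \<Rightarrow> complex"
  where "schur_function \<mu> z =
    (if z = 0 then Lim (at 0) (schur_quotient \<mu>) else schur_quotient \<mu> z)"

text \<open>Elements of \<open>L\<^sup>2(\<mu>)\<close> are represented by square-integrable functions; equality in
  \<open>L\<^sup>2(\<mu>)\<close> is equality almost everywhere.\<close>

definition L2 :: "complex measure \<Rightarrow> (complex \<Rightarrow> complex) set"
  where "L2 \<mu> = {f \<in> borel_measurable \<mu>. integrable \<mu> (\<lambda>\<zeta>. (cmod (f \<zeta>))\<^sup>2)}"

definition L2_inner ::
    "complex measure \<Rightarrow> (complex \<Rightarrow> complex) \<Rightarrow> (complex \<Rightarrow> complex) \<Rightarrow> complex"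
  where "L2_inner \<mu> f g = (\<integral>\<zeta>. f \<zeta> * cnj (g \<zeta>) \<partial>\<mu>)"

definition L2_minus_constants :: "complex measure \<Rightarrow> (complex \<Rightarrow> complex) set"
  where "L2_minus_constants \<mu> = {f \<in> L2 \<mu>. \<forall>c. L2_inner \<mu> f (\<lambda>_. c) = 0}"

text \<open>The orthogonal projection of \<open>g\<close> onto \<open>V\<close> (a closed subspace); it is determined up to
  equality almost everywhere.\<close>

definition L2_proj ::
    "complex measure \<Rightarrow> (complex \<Rightarrow> complex) set \<Rightarrow> (complex \<Rightarrow> complex) \<Rightarrow> (complex \<Rightarrow> complex)"
  where "L2_proj \<mu> V g =
    (SOME k. k \<in> V \<and> (\<forall>h\<in>V. L2_inner \<mu> (\<lambda>\<zeta>. g \<zeta> - k \<zeta>) h = 0))"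

definition compressed_mult :: "complex measure \<Rightarrow> (complex \<Rightarrow> complex) \<Rightarrow> (complex \<Rightarrow> complex)"
  where "compressed_mult \<mu> h = L2_proj \<mu> (L2_minus_constants \<mu>) (\<lambda>\<zeta>. \<zeta> * h \<zeta>)"

definition unitary_onto_L2 ::
    "complex measure \<Rightarrow> (complex \<Rightarrow> complex) set \<Rightarrow>
     ('a::chilbert_space \<Rightarrow> complex \<Rightarrow> complex) \<Rightarrow> bool"
  where "unitary_onto_L2 \<mu> V U \<longleftrightarrow>
    (\<forall>x. U x \<in> V) \<and>
    (\<forall>x y. AE \<zeta> in \<mu>. U (x + y) \<zeta> = U x \<zeta> + U y \<zeta>) \<and>
    (\<forall>c x. AE \<zeta> in \<mu>. U (c *\<^sub>C x) \<zeta> = c * U x \<zeta>) \<and>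
    (\<forall>x y. L2_inner \<mu> (U x) (U y) = cinner x y) \<and>
    (\<forall>h\<in>V. \<exists>x. AE \<zeta> in \<mu>. U x \<zeta> = h \<zeta>)"

definition unitarily_equivalent_L2 ::
    "('a::chilbert_space \<Rightarrow> 'a) \<Rightarrow> complex measure \<Rightarrow> (complex \<Rightarrow> complex) set \<Rightarrow>
     ((complex \<Rightarrow> complex) \<Rightarrow> (complex \<Rightarrow> complex)) \<Rightarrow> bool"
  where "unitarily_equivalent_L2 T \<mu> V S \<longleftrightarrow>
    (\<exists>U. unitary_onto_L2 \<mu> V U \<and> (\<forall>x. AE \<zeta> in \<mu>. U (T x) \<zeta> = S (U x) \<zeta>))"

end

theory Submission
  imports Defs
begin

text \<open>A contraction \<open>T\<close> with rank one defects has a unitary extension by one dimension. Its defect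
  operators are \<open>d\<close> times the projections onto unit vectors \<open>e\<close> and \<open>e'\<close>, with the same \<open>d\<close>, and
  \<open>T e = \<tau> e'\<close> with \<open>|\<tau>|\<^sup>2 = 1 - d\<^sup>2\<close> (\<open>rank_one_contraction_exists\<close>). So the
  Julia operator \<open>J (x, c) = (T x + c d e', d \<langle>x, e\<rangle> - c cnj \<tau>)\<close> on the direct sum of \<open>H\<close> and \<open>\<complex>\<close> is
  unitary, and \<open>T\<close> is its compression to \<open>H\<close>. The vectors of \<open>H\<close> orthogonal to the two-sided orbit
  of \<open>(0, 1)\<close> form a subspace that reduces \<open>T\<close> and on which \<open>T\<close> is unitary. As \<open>T\<close> is completely
  nonunitary, this subspace is zero, that is, \<open>(0, 1)\<close> is cyclic for \<open>J\<close> (\<open>orbit_total\<close>).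

  The spectral theorem for a unitary operator with a cyclic vector turns \<open>J\<close> into multiplication
  by \<open>\<zeta>\<close> on \<open>L\<^sup>2(\<mu>)\<close> and \<open>(0, 1)\<close> into the constant function \<open>1\<close> (\<open>spectral_model\<close>). Then \<open>H\<close>
  becomes the complement of the constants and \<open>T\<close> the compressed multiplication
  (\<open>compressed_mult_W\<close>). The spectral theorem is obtained in this special case from two
  facts about the stationary sequence \<open>J\<^sup>n (0, 1)\<close>. Herglotz' theorem (\<open>herglotz_representation\<close>)
  provides \<open>\<mu>\<close> as a weak limit of discrete measures on roots of unity. The Kolmogorov isomorphism
  (\<open>kolmogorov_isomorphism\<close>) rests on the completeness of \<open>L\<^sup>2(\<mu>)\<close> and on the uniqueness of
  Fourier coefficients.

  For the Schur function, let \<open>\<phi>(z) = -\<tau> + z d\<^sup>2 \<langle>(I - z T\<^sup>*)\<^sup>-\<^sup>1 e, e'\<rangle>\<close>. This is the characteristic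
  function of \<open>T\<close> in the coordinates given by \<open>e\<close> and \<open>e'\<close> (\<open>char_fun_eq\<close>). A Schur complement
  shows that \<open>(I - z J\<^sup>*)\<^sup>-\<^sup>1\<close> has the corner entry \<open>a = 1 / (1 - z \<phi>(z))\<close> (\<open>resolvent_corner\<close>).
  In the model this entry is the integral of \<open>\<zeta> / (\<zeta> - z)\<close>, so \<open>F(z) = 2 a - 1\<close>, and
  \<open>(F(z) - 1) / (F(z) + 1) = z \<phi>(z)\<close> (\<open>schur_quotient_eq\<close>).

  Underneath lie the projection theorem and the Riesz representation, which make \<open>cadjoint\<close> an
  adjoint, and the existence and uniqueness of the positive square root of \<open>I - B\<close> for a
  self-adjoint contraction \<open>B\<close>, which give \<open>defect_op\<close> its meaning.\<close>

section \<open>Complex inner product spaces\<close>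

lemma unimodular_inverse: "cmod w = 1 \<Longrightarrow> inverse w = cnj w"
  by (rule inverse_unique) (simp add: complex_norm_square[symmetric])

lemma cinner_add_right: "cinner x (y + z) = cinner x y + cinner x z"
  for x :: "'a::complex_inner"
  by (metis cinner_add_left cinner_commute complex_cnj_add)

lemma cinner_scaleC_right: "cinner x (a *\<^sub>C y) = cnj a * cinner x y"
  for x :: "'a::complex_inner"
  by (metis cinner_commute cinner_scaleC_left complex_cnj_mult)

lemma cinner_zero_left [simp]: "cinner 0 x = 0"
  and cinner_zero_right [simp]: "cinner x 0 = 0"
  for x :: "'a::complex_inner"
  using cinner_add_left[of 0 0 x] cinner_add_right[of x 0 0] by simp_all

lemma cinner_minus_left [simp]: "cinner (- x) y = - cinner x y"
  and cinner_minus_right [simp]: "cinner y (- x) = - cinner y x"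
  for x :: "'a::complex_inner"
  using cinner_add_left[of x "- x" y] cinner_add_right[of y x "- x"]
  by (simp_all add: eq_neg_iff_add_eq_0 add.commute)

lemma cinner_diff_left: "cinner (x - y) z = cinner x z - cinner y z"
  and cinner_diff_right: "cinner z (x - y) = cinner z x - cinner z y"
  for x :: "'a::complex_inner"
  using cinner_add_left[of x "- y" z] cinner_add_right[of z x "- y"] by simp_all

lemma cinner_scaleR_left: "cinner (r *\<^sub>R x) y = of_real r * cinner x y"
  and cinner_scaleR_right: "cinner y (r *\<^sub>R x) = of_real r * cinner y x"
  for x :: "'a::complex_inner"
  by (simp_all add: scaleR_eq_scaleC cinner_scaleC_left cinner_scaleC_right)

lemmas cinner_simps = cinner_add_left cinner_add_right cinner_diff_left cinner_diff_right
  cinner_scaleC_left cinner_scaleC_right cinner_scaleR_left cinner_scaleR_right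

lemma cinner_self: "cinner x x = of_real ((norm x)\<^sup>2)" for x :: "'a::complex_inner"
proof -
  have "Im (cinner x x) = 0"
    using cinner_commute[of x x] by (metis complex_cnj_cancel_iff complex_is_Real_iff Reals_cnj_iff)
  then show ?thesis
    by (simp add: complex_eq_iff power2_norm_eq_inner inner_eq_Re_cinner)
qed

lemma cinner_eq_zero_iff [simp]: "cinner x x = 0 \<longleftrightarrow> x = 0" for x :: "'a::complex_inner"
  by (simp add: cinner_self)

lemma norm_eq_of_cinner_eq:
  fixes x :: "'a::complex_inner" and y :: "'b::complex_inner"
  assumes "cinner x x = cinner y y"
  shows "norm x = norm y"
  using assms by (simp add: cinner_self del: of_real_power)

lemma cinner_ext:
  fixes x y :: "'a::complex_inner"
  assumes "\<And>z. cinner z x = cinner z y"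
  shows "x = y"
  using assms[of "x - y"] cinner_eq_zero_iff[of "x - y"] by (simp add: cinner_diff_right)

lemma norm_scaleC [simp]: "norm (a *\<^sub>C x) = cmod a * norm x" for x :: "'a::complex_inner"
proof -
  have "cinner (a *\<^sub>C x) (a *\<^sub>C x) = (a * cnj a) * cinner x x"
    by (simp add: cinner_simps)
  also have "\<dots> = of_real ((cmod a * norm x)\<^sup>2)"
    by (simp only: cinner_self complex_norm_square[symmetric] of_real_mult[symmetric]
        power_mult_distrib)
  finally show ?thesis
    by (simp only: cinner_self of_real_eq_iff power2_eq_iff_nonneg norm_ge_zero
        mult_nonneg_nonneg)
qed

lemma cmod_cinner_le: "cmod (cinner x y) \<le> norm x * norm y" for x :: "'a::complex_inner"
proof (cases "cinner x y = 0")
  case False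
  \<comment> \<open>Rotating \<open>x\<close> makes the inner product real, where the real inequality applies.\<close>
  define u where "u = cnj (cinner x y) / cmod (cinner x y)"
  have "cinner (u *\<^sub>C x) y = of_real (cmod (cinner x y))"
    using False by (simp add: u_def cinner_simps complex_norm_square[symmetric] power2_eq_square
        mult.commute)
  then have "cmod (cinner x y) = inner (u *\<^sub>C x) y"
    by (simp add: inner_eq_Re_cinner)
  also have "\<dots> \<le> norm (u *\<^sub>C x) * norm y"
    by (rule norm_cauchy_schwarz)
  finally show ?thesis
    using False by (simp add: u_def norm_divide)
qed simp

lemma bounded_bilinear_cinner: "bounded_bilinear (cinner :: 'a::complex_inner \<Rightarrow> 'a \<Rightarrow> complex)"
  by (rule bounded_bilinear.intro)
    (auto simp: cinner_simps scaleR_conv_of_real intro!: exI[of _ 1] cmod_cinner_le)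

lemma bounded_bilinear_scaleC:
  "bounded_bilinear (scaleC :: complex \<Rightarrow> 'a::complex_inner \<Rightarrow> 'a)"
  by (rule bounded_bilinear.intro)
    (auto simp: scaleC_add_left scaleC_add_right scaleR_eq_scaleC scaleC_scaleC mult.commute
      scaleR_conv_of_real scaleC_complex_def intro!: exI[of _ 1])

lemmas tendsto_cinner [tendsto_intros] = bounded_bilinear.tendsto[OF bounded_bilinear_cinner]
lemmas tendsto_scaleC [tendsto_intros] = bounded_bilinear.tendsto[OF bounded_bilinear_scaleC]
lemmas continuous_on_cinner [continuous_intros] =
  bounded_bilinear.continuous_on[OF bounded_bilinear_cinner]

lemma bounded_clinearI:
  fixes T :: "'a::complex_inner \<Rightarrow> 'b::complex_inner"
  assumes "\<And>x y. T (x + y) = T x + T y"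
    and "\<And>c x. T (c *\<^sub>C x) = c *\<^sub>C T x"
    and "\<And>x. norm (T x) \<le> K * norm x"
  shows "bounded_clinear T"
  unfolding bounded_clinear_def
proof
  show "Vector_Spaces.linear (*\<^sub>C) (*\<^sub>C) T"
    by (rule Vector_Spaces.linear.intro)
      (use assms in \<open>auto simp: Vector_Spaces.linear_def module_hom_def module_hom_axioms_def
          complex_vector.module_axioms complex_vector.vector_space_axioms\<close>)
  show "bounded_linear T"
    by (rule bounded_linear_intro[of _ K])
      (use assms in \<open>auto simp: scaleR_eq_scaleC mult.commute\<close>)
qed

lemma
  fixes T :: "'a::complex_inner \<Rightarrow> 'b::complex_inner"
  assumes "bounded_clinear T"
  shows bounded_clinear_add: "T (x + y) = T x + T y"
    and bounded_clinear_scaleC: "T (c *\<^sub>C x) = c *\<^sub>C T x"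
    and bounded_clinear_diff: "T (x - y) = T x - T y"
    and bounded_clinear_zero: "T 0 = 0"
    and bounded_clinear_imp_bounded_linear: "bounded_linear T"
proof -
  interpret bounded_linear T using assms by (simp add: bounded_clinear_def)
  show "T (x + y) = T x + T y" "T (x - y) = T x - T y" "T 0 = 0" "bounded_linear T"
    by (simp_all add: add diff zero bounded_linear_axioms)
  show "T (c *\<^sub>C x) = c *\<^sub>C T x"
    using assms by (simp add: bounded_clinear_def linear_iff Vector_Spaces.linear_def
        module_hom_def module_hom_axioms_def)
qed

lemma contraction_bounded_clinear: "contraction T \<Longrightarrow> bounded_clinear T"
  by (simp add: contraction_def)

lemma contraction_norm_le: "norm (T x) \<le> norm x" if "contraction T"
  using that onorm[of T x] bounded_clinear_imp_bounded_linear[of T]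
    mult_right_mono[of "onorm T" 1 "norm x"]
  by (auto simp: contraction_def)

lemma contractionI:
  assumes "bounded_clinear T" "\<And>x. norm (T x) \<le> norm x"
  shows "contraction T"
  using assms onorm_bound[of 1 T] by (simp add: contraction_def)

section \<open>Orthogonal projection and adjoints\<close>

text \<open>The distance from \<open>x\<close> to \<open>M\<close> is attained: a minimizing sequence is Cauchy by the
  parallelogram law. The difference to the nearest point is orthogonal to \<open>M\<close>, because
  subtracting its component along \<open>y \<in> M\<close> would otherwise shorten it.\<close>

lemma orthogonal_decomposition:
  fixes M :: "'a::chilbert_space set"
  assumes M: "complex_vector.subspace M" "closed M"
  obtains m where "m \<in> M" "\<And>y. y \<in> M \<Longrightarrow> cinner (x - m) y = 0"
proof -
  define d where "d = infdist x M"
  have "M \<noteq> {}"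
    using complex_vector.subspace_0[OF M(1)] by auto
  have d_le: "d \<le> norm (x - y)" if "y \<in> M" for y
    using infdist_le[OF that, of x] by (simp add: d_def dist_norm)
  have "d \<ge> 0"
    by (simp add: d_def infdist_nonneg)
  have "\<exists>y\<in>M. norm (x - y) < d + 1 / real (Suc n)" for n
  proof -
    have "Inf (dist x ` M) < d + 1 / real (Suc n)"
      using \<open>M \<noteq> {}\<close> by (simp add: d_def infdist_notempty)
    then show ?thesis
      using cInf_lessD[of "dist x ` M"] \<open>M \<noteq> {}\<close> by (fastforce simp: dist_norm)
  qed
  then obtain s where s: "\<And>n. s n \<in> M" "\<And>n. norm (x - s n) < d + 1 / real (Suc n)"
    by metis
  have lim_norm: "(\<lambda>n. norm (x - s n)) \<longlonglongrightarrow> d"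
  proof (rule tendsto_sandwich[OF _ _ tendsto_const])
    show "(\<lambda>n. d + 1 / real (Suc n)) \<longlonglongrightarrow> d"
      using tendsto_add[OF tendsto_const[of d] LIMSEQ_inverse_real_of_nat]
      by (simp add: inverse_eq_divide)
  qed (use d_le s in \<open>auto intro!: always_eventually less_imp_le\<close>)
  have para: "(norm (y - z))\<^sup>2 \<le> 2 * (norm (x - y))\<^sup>2 + 2 * (norm (x - z))\<^sup>2 - 4 * d\<^sup>2"
    if "y \<in> M" "z \<in> M" for y z
  proof -
    have "(1/2) *\<^sub>R (y + z) \<in> M"
      unfolding scaleR_eq_scaleC
      by (intro complex_vector.subspace_scale[OF M(1)] complex_vector.subspace_add[OF M(1)] that)
    then have "d\<^sup>2 \<le> (norm (x - (1/2) *\<^sub>R (y + z)))\<^sup>2"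
      using d_le \<open>d \<ge> 0\<close> by (intro power_mono) auto
    moreover have "(norm (y - z))\<^sup>2 + 4 * (norm (x - (1/2) *\<^sub>R (y + z)))\<^sup>2 =
        2 * (norm (x - y))\<^sup>2 + 2 * (norm (x - z))\<^sup>2"
      by (simp add: power2_norm_eq_inner inner_simps algebra_simps inner_commute)
    ultimately show ?thesis by simp
  qed
  have "Cauchy s"
  proof (rule CauchyI)
    fix e :: real assume "e > 0"
    have "(\<lambda>n. (norm (x - s n))\<^sup>2) \<longlonglongrightarrow> d\<^sup>2"
      by (intro tendsto_intros lim_norm)
    then have "eventually (\<lambda>n. (norm (x - s n))\<^sup>2 < d\<^sup>2 + e\<^sup>2 / 4) sequentially"
      by (rule order_tendstoD) (use \<open>e > 0\<close> in simp)
    then obtain N where N: "\<And>n. n \<ge> N \<Longrightarrow> (norm (x - s n))\<^sup>2 < d\<^sup>2 + e\<^sup>2 / 4"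
      by (auto simp: eventually_sequentially)
    have "norm (s m - s n) < e" if "m \<ge> N" "n \<ge> N" for m n
    proof (rule power2_less_imp_less)
      show "(norm (s m - s n))\<^sup>2 < e\<^sup>2"
        using para[OF s(1) s(1), of m n] N[OF that(1)] N[OF that(2)] by linarith
    qed (use \<open>e > 0\<close> in simp)
    then show "\<exists>N. \<forall>m\<ge>N. \<forall>n\<ge>N. norm (s m - s n) < e" by blast
  qed
  then obtain m where m: "s \<longlonglongrightarrow> m"
    using Cauchy_convergent convergent_def by blast
  have "m \<in> M"
    using closed_sequentially[OF M(2) _ m] s(1) by blast
  have norm_m: "norm (x - m) = d"
    by (rule LIMSEQ_unique[OF _ lim_norm]) (intro tendsto_intros m)
  have "cinner (x - m) y = 0" if "y \<in> M" for y
  proof (cases "y = 0")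
    case False
    define c where "c = cinner (x - m) y / of_real ((norm y)\<^sup>2)"
    have "m + c *\<^sub>C y \<in> M"
      by (intro complex_vector.subspace_scale[OF M(1)] complex_vector.subspace_add[OF M(1)]
          that \<open>m \<in> M\<close>)
    then have "norm (x - m) \<le> norm (x - m - c *\<^sub>C y)"
      using d_le[of "m + c *\<^sub>C y"] by (simp add: norm_m algebra_simps)
    then have "(norm (x - m))\<^sup>2 \<le> (norm (x - m - c *\<^sub>C y))\<^sup>2"
      by (simp add: power_mono)
    also have "complex_of_real \<dots> = of_real ((norm (x - m))\<^sup>2) - c * cnj c * of_real ((norm y)\<^sup>2)"
    proof -
      have c: "cinner (x - m) y = c * of_real ((norm y)\<^sup>2)"
        using False by (simp add: c_def)
      then have c': "cinner y (x - m) = cnj c * of_real ((norm y)\<^sup>2)"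
        by (subst cinner_commute) simp
      have expand: "cinner (v - c *\<^sub>C y) (v - c *\<^sub>C y) =
          cinner v v - c * cinner y v - cnj c * cinner v y + c * cnj c * cinner y y" for v
        by (simp add: cinner_simps algebra_simps)
      show ?thesis
        unfolding cinner_self[symmetric, of "x - m - c *\<^sub>C y"]
        unfolding expand unfolding c c' cinner_self
        by (simp add: algebra_simps)
    qed
    then have "(norm (x - m - c *\<^sub>C y))\<^sup>2 = (norm (x - m))\<^sup>2 - (cmod c)\<^sup>2 * (norm y)\<^sup>2"
      unfolding complex_norm_square[symmetric] of_real_mult[symmetric] of_real_diff[symmetric]
      by (simp only: of_real_eq_iff)
    finally have "c = 0"
      using False by (simp add: mult_le_0_iff)
    then show ?thesis
      using False by (simp add: c_def)
  qed simp
  then show ?thesis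
    using that \<open>m \<in> M\<close> by blast
qed

lemma riesz_representation:
  fixes f :: "'a::chilbert_space \<Rightarrow> complex"
  assumes f: "bounded_clinear f"
  obtains z where "\<And>x. f x = cinner x z"
proof (cases "\<forall>x. f x = 0")
  case True
  then show ?thesis using that[of 0] by simp
next
  case False
  then obtain x where x: "f x \<noteq> 0" by blast
  have sub: "complex_vector.subspace {x. f x = 0}"
    by (rule complex_vector.subspaceI)
      (auto simp: bounded_clinear_add[OF f] bounded_clinear_scaleC[OF f] bounded_clinear_zero[OF f]
        scaleC_complex_def)
  have "closed {x. f x = 0}"
    using bounded_clinear_imp_bounded_linear[OF f]
    by (intro closed_Collect_eq linear_continuous_on continuous_on_const) auto
  then obtain m where m: "f m = 0" "\<And>y. f y = 0 \<Longrightarrow> cinner (x - m) y = 0"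
    using orthogonal_decomposition[OF sub, of x] by auto
  define w where "w = x - m"
  have fw: "f w \<noteq> 0"
    using x m by (simp add: w_def bounded_clinear_diff[OF f])
  then have w: "w \<noteq> 0"
    using bounded_clinear_zero[OF f] by auto
  have orth: "cinner y w = 0" if "f y = 0" for y
    using m(2)[OF that] by (metis cinner_commute complex_cnj_zero w_def)
  have "f y = cinner y ((cnj (f w) / of_real ((norm w)\<^sup>2)) *\<^sub>C w)" for y
  proof -
    have "f (y - (f y / f w) *\<^sub>C w) = 0"
      using fw by (simp add: bounded_clinear_diff[OF f] bounded_clinear_scaleC[OF f]
          scaleC_complex_def)
    from orth[OF this] have "cinner y w = (f y / f w) * of_real ((norm w)\<^sup>2)"
      by (simp add: cinner_simps cinner_self)
    then show ?thesis
      using fw w by (simp add: cinner_simps)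
  qed
  then show ?thesis using that by blast
qed

lemma cinner_cadjoint:
  fixes T :: "'a::chilbert_space \<Rightarrow> 'a"
  assumes T: "bounded_clinear T"
  shows "cinner (T x) y = cinner x (cadjoint T y)"
proof -
  have "\<exists>z. \<forall>x. cinner (T x) y = cinner x z" for y
  proof (rule riesz_representation[of "\<lambda>x. cinner (T x) y"])
    obtain K where K: "\<And>x. norm (T x) \<le> norm x * K"
      using bounded_linear.bounded[OF bounded_clinear_imp_bounded_linear[OF T]] by blast
    show "bounded_clinear (\<lambda>x. cinner (T x) y)"
    proof (rule bounded_clinearI)
      show "cmod (cinner (T x) y) \<le> (K * norm y) * norm x" for x
        using order_trans[OF cmod_cinner_le mult_right_mono[OF K norm_ge_zero]]
        by (simp add: mult_ac)
    qed (simp_all add: bounded_clinear_add[OF T] bounded_clinear_scaleC[OF T] cinner_simps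
        scaleC_complex_def)
  qed blast
  then obtain S where S: "\<And>x y. cinner (T x) y = cinner x (S y)"
    by metis
  have "cadjoint T = S"
    unfolding cadjoint_def
  proof (rule the_equality)
    fix S' assume "\<forall>x y. cinner (T x) y = cinner x (S' y)"
    then show "S' = S"
      by (metis S cinner_ext ext)
  qed (simp add: S)
  then show ?thesis by (simp add: S)
qed

lemma cinner_cadjoint_left:
  "bounded_clinear T \<Longrightarrow> cinner (cadjoint T x) y = cinner x (T y)"
  by (metis cinner_cadjoint cinner_commute)

lemma contraction_cadjoint:
  assumes "contraction T"
  shows "contraction (cadjoint T)"
proof -
  note T = contraction_bounded_clinear[OF assms]
  have norm_le: "norm (cadjoint T x) \<le> norm x" for x
  proof -
    have "complex_of_real ((norm (cadjoint T x))\<^sup>2) = cinner (T (cadjoint T x)) x"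
      by (simp only: cinner_self[symmetric] cinner_cadjoint[OF T])
    then have "(norm (cadjoint T x))\<^sup>2 = cmod (cinner (T (cadjoint T x)) x)"
      by (metis norm_of_real abs_power2)
    also have "\<dots> \<le> norm (T (cadjoint T x)) * norm x"
      by (rule cmod_cinner_le)
    also have "\<dots> \<le> norm (cadjoint T x) * norm x"
      by (intro mult_right_mono contraction_norm_le[OF assms]) simp
    finally show ?thesis
      by (cases "cadjoint T x = 0") (auto simp: power2_eq_square)
  qed
  moreover have "bounded_clinear (cadjoint T)"
    by (rule bounded_clinearI[where K = 1]; (rule cinner_ext)?)
      (simp_all add: norm_le cinner_cadjoint[OF T, symmetric] cinner_add_right cinner_scaleC_right)
  ultimately show ?thesis
    by (intro contractionI)
qed

lemma cadjoint_cadjoint: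
  assumes "contraction T"
  shows "cadjoint (cadjoint T) = T"
proof
  fix y
  note T = contraction_bounded_clinear[OF assms]
    and T' = contraction_bounded_clinear[OF contraction_cadjoint[OF assms]]
  show "cadjoint (cadjoint T) y = T y"
    by (rule cinner_ext) (simp add: cinner_cadjoint[OF T', symmetric] cinner_cadjoint_left[OF T])
qed

lemma bij_one_minus_strict_contraction:
  fixes A :: "'a::chilbert_space \<Rightarrow> 'a"
  assumes A: "bounded_clinear A" "\<And>x. norm (A x) \<le> norm x" and z: "cmod z < 1"
  shows "bij (\<lambda>y. y - z *\<^sub>C A y)"
proof -
  have "\<exists>!y. w + z *\<^sub>C A y = y" for w
  proof (rule banach_fix_type[of "cmod z"])
    show "\<forall>x y. dist (w + z *\<^sub>C A x) (w + z *\<^sub>C A y) \<le> cmod z * dist x y"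
      using A(2) by (auto simp: dist_norm bounded_clinear_diff[OF A(1), symmetric]
          complex_vector.scale_right_diff_distrib[symmetric] intro!: mult_left_mono)
  qed (use z in auto)
  moreover have "w + z *\<^sub>C A y = y \<longleftrightarrow> y - z *\<^sub>C A y = w" for w y
    by (auto simp: algebra_simps)
  ultimately have "\<exists>!y. y - z *\<^sub>C A y = w" for w
    by simp
  then show ?thesis
    by (auto simp: bij_iff)
qed

section \<open>The positive square root\<close>

text \<open>The operators \<open>p(B)\<close> for polynomials \<open>p\<close> with nonnegative coefficients and zero
  constant term, indexed by the value \<open>t = p(1)\<close>. When \<open>B\<close> is a contraction, this value
  bounds the norm of \<open>p(B)\<close>.\<close>

inductive nonneg_poly_op :: "('a::complex_inner \<Rightarrow> 'a) \<Rightarrow> real \<Rightarrow> ('a \<Rightarrow> 'a) \<Rightarrow> bool" for B where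
  zero: "nonneg_poly_op B 0 (\<lambda>x. 0)"
| base: "nonneg_poly_op B 1 B"
| add: "nonneg_poly_op B s A \<Longrightarrow> nonneg_poly_op B t C \<Longrightarrow> nonneg_poly_op B (s + t) (\<lambda>x. A x + C x)"
| comp: "nonneg_poly_op B s A \<Longrightarrow> nonneg_poly_op B t C \<Longrightarrow> nonneg_poly_op B (s * t) (\<lambda>x. A (C x))"
| scale: "nonneg_poly_op B s A \<Longrightarrow> r \<ge> 0 \<Longrightarrow> nonneg_poly_op B (r * s) (\<lambda>x. r *\<^sub>R A x)"

lemma bounded_clinear_scaleR: "bounded_clinear T \<Longrightarrow> T (r *\<^sub>R x) = r *\<^sub>R T x"
  by (simp add: scaleR_eq_scaleC bounded_clinear_scaleC)

lemma nonneg_poly_op_norm_le: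
  assumes "nonneg_poly_op B t A" "\<And>x. norm (B x) \<le> norm x"
  shows "t \<ge> 0" "norm (A x) \<le> t * norm x"
proof -
  have "t \<ge> 0 \<and> (\<forall>x. norm (A x) \<le> t * norm x)"
    using assms(1)
  proof induction
    case (add s A t C)
    then show ?case
      by (auto simp: distrib_right intro: order_trans[OF norm_triangle_ineq add_mono])
  next
    case (comp s A t C)
    then show ?case
      by (auto simp: mult.assoc
          intro: order_trans[of "norm (A (C x))" "s * norm (C x)" for x] mult_left_mono)
  next
    case (scale s A r)
    then show ?case
      by (auto simp: mult.assoc intro: mult_left_mono)
  qed (use assms(2) in auto)
  then show "t \<ge> 0" "norm (A x) \<le> t * norm x" by auto
qed

lemma nonneg_poly_op_bounded_clinear:
  assumes A: "nonneg_poly_op B t A" and B: "bounded_clinear B" "\<And>x. norm (B x) \<le> norm x"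
  shows "bounded_clinear A"
proof (rule bounded_clinearI[OF _ _ nonneg_poly_op_norm_le(2)[OF A B(2)]])
  have "(\<forall>x y. A (x + y) = A x + A y) \<and> (\<forall>c x. A (c *\<^sub>C x) = c *\<^sub>C A x)"
    using A
    by induction (auto simp: B(1) bounded_clinear_add bounded_clinear_scaleC scaleC_add_right
        scaleR_eq_scaleC scaleC_scaleC mult.commute)
  then show "A (x + y) = A x + A y" "A (c *\<^sub>C x) = c *\<^sub>C A x" for x y c
    by auto
qed

lemma nonneg_poly_op_commute:
  assumes "nonneg_poly_op B t A" "bounded_clinear C" "\<And>x. C (B x) = B (C x)"
  shows "C (A x) = A (C x)"
  using assms(1)
  by (induction arbitrary: x) (simp_all add: assms(3) bounded_clinear_zero[OF assms(2)]
      bounded_clinear_add[OF assms(2)] bounded_clinear_scaleR[OF assms(2)])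

lemma nonneg_poly_op_commute_self:
  assumes "nonneg_poly_op B t A" "nonneg_poly_op B s C"
    and B: "bounded_clinear B" "\<And>x. norm (B x) \<le> norm x"
  shows "C (A x) = A (C x)"
proof (rule nonneg_poly_op_commute[OF assms(1) nonneg_poly_op_bounded_clinear[OF assms(2) B]])
  show "C (B x) = B (C x)" for x
    using nonneg_poly_op_commute[OF assms(2) B(1)] by simp
qed

lemma nonneg_poly_op_selfadjoint:
  assumes "nonneg_poly_op B t A"
    and B: "bounded_clinear B" "\<And>x. norm (B x) \<le> norm x"
    and "\<And>x y. cinner (B x) y = cinner x (B y)"
  shows "cinner (A x) y = cinner x (A y)"
  using assms(1)
proof (induction arbitrary: x y)
  case (comp s A t C)
  then show ?case
    using nonneg_poly_op_commute_self[OF comp(1,2) B] by simp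
qed (simp_all add: assms(4) cinner_simps)

text \<open>If \<open>B\<close> is a self-adjoint contraction, then \<open>I - B\<close> has the square root \<open>I - Y\<close>, where
  \<open>Y\<close> is the limit of the iteration \<open>Y \<leftarrow> (B + Y\<^sup>2) / 2\<close> from \<open>0\<close>. Every iterate is
  a polynomial in \<open>B\<close> with nonnegative coefficients, and so is the difference of consecutive
  iterates. Hence operator norms are dominated by the scalar iteration \<open>t \<leftarrow> (1 + t\<^sup>2) / 2\<close>, which
  increases and stays below \<open>1\<close>.\<close>

lemma sqrt_one_minus_exists:
  fixes B :: "'a::chilbert_space \<Rightarrow> 'a"
  assumes B: "bounded_clinear B" "\<And>x. norm (B x) \<le> norm x"
    and sa: "\<And>x y. cinner (B x) y = cinner x (B y)"
  obtains S where "positive_op S" "\<And>x. S (S x) = x - B x"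
    "\<And>C x. bounded_clinear C \<Longrightarrow> (\<And>x. C (B x) = B (C x)) \<Longrightarrow> C (S x) = S (C x)"
proof -
  define t :: "nat \<Rightarrow> real" where "t = rec_nat 0 (\<lambda>_ s. (1/2) * (1 + s * s))"
  define Y where "Y = rec_nat (\<lambda>x. 0) (\<lambda>_ A x. (1/2) *\<^sub>R (B x + A (A x)))"
  have t_simps: "t 0 = 0" "t (Suc n) = (1/2) * (1 + t n * t n)" for n
    by (simp_all add: t_def)
  have Y_simps: "Y 0 = (\<lambda>x. 0)" "Y (Suc n) = (\<lambda>x. (1/2) *\<^sub>R (B x + Y n (Y n x)))" for n
    by (simp_all add: Y_def)
  have poly_Y: "nonneg_poly_op B (t n) (Y n)" for n
  proof (induction n)
    case (Suc n)
    then show ?case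
      unfolding t_simps Y_simps by (intro nonneg_poly_op.intros) auto
  qed (auto simp: t_simps Y_simps intro: nonneg_poly_op.zero)
  note Y_lin = nonneg_poly_op_bounded_clinear[OF poly_Y B]
  have poly_diff: "nonneg_poly_op B (t (Suc n) - t n) (\<lambda>x. Y (Suc n) x - Y n x)" for n
  proof (induction n)
    case 0
    then show ?case
      using nonneg_poly_op.scale[OF nonneg_poly_op.base, of "1/2" B]
      by (simp add: t_simps Y_simps)
  next
    case (Suc n)
    have "nonneg_poly_op B ((1/2) * ((t (Suc n) - t n) * (t (Suc n) + t n)))
       (\<lambda>x. (1/2) *\<^sub>R ((\<lambda>x. Y (Suc n) x - Y n x) ((\<lambda>x. Y (Suc n) x + Y n x) x)))"
      by (intro nonneg_poly_op.scale nonneg_poly_op.comp[OF Suc] nonneg_poly_op.add poly_Y) auto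
    moreover have "(1/2) * ((t (Suc n) - t n) * (t (Suc n) + t n)) = t (Suc (Suc n)) - t (Suc n)"
      unfolding t_simps(2)[of "Suc n"] by (subst t_simps(2)[of n], simp add: t_simps algebra_simps)
    moreover have "(1/2) *\<^sub>R (Y (Suc n) (Y (Suc n) x + Y n x) - Y n (Y (Suc n) x + Y n x)) =
        Y (Suc (Suc n)) x - Y (Suc n) x" for x
    proof -
      have "Y (Suc n) (Y n x) = Y n (Y (Suc n) x)"
        by (rule nonneg_poly_op_commute_self[OF poly_Y poly_Y B])
      then have "Y (Suc n) (Y (Suc n) x + Y n x) - Y n (Y (Suc n) x + Y n x) =
          (B x + Y (Suc n) (Y (Suc n) x)) - (B x + Y n (Y n x))"
        unfolding bounded_clinear_add[OF Y_lin[of n]] bounded_clinear_add[OF Y_lin[of "Suc n"]]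
        by simp
      then have "(1/2) *\<^sub>R (Y (Suc n) (Y (Suc n) x + Y n x) - Y n (Y (Suc n) x + Y n x)) =
          (1/2) *\<^sub>R (B x + Y (Suc n) (Y (Suc n) x)) - (1/2) *\<^sub>R (B x + Y n (Y n x))"
        by (simp only: scaleR_diff_right)
      also have "(1/2) *\<^sub>R (B x + Y (Suc n) (Y (Suc n) x)) = Y (Suc (Suc n)) x"
        by (simp only: Y_simps(2)[of "Suc n"])
      also have "(1/2) *\<^sub>R (B x + Y n (Y n x)) = Y (Suc n) x"
        by (simp only: Y_simps(2)[of n])
      finally show ?thesis .
    qed
    ultimately show ?case by (simp only:)
  qed
  have t_le_1: "0 \<le> t n \<and> t n \<le> 1" for n
  proof (induction n)
    case (Suc n)
    then have "t n * t n \<le> 1 * 1" by (intro mult_mono) auto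
    then show ?case by (simp add: t_simps)
  qed (simp add: t_simps)
  have "incseq t"
    using nonneg_poly_op_norm_le(1)[OF poly_diff B(2)] by (intro incseq_SucI) simp
  then have "convergent t"
    using Bseq_mono_convergent[of t] t_le_1 BseqI'[of t 1] by (auto simp: mono_def)
  have Y_diff: "norm (Y (n + k) x - Y n x) \<le> (t (n + k) - t n) * norm x" for n k x
  proof (induction k)
    case (Suc k)
    have "norm (Y (n + Suc k) x - Y n x) \<le>
        norm (Y (Suc (n + k)) x - Y (n + k) x) + norm (Y (n + k) x - Y n x)"
      by (rule order_trans[OF _ norm_triangle_ineq]) simp
    also have "\<dots> \<le> (t (Suc (n + k)) - t (n + k)) * norm x + (t (n + k) - t n) * norm x"
      using nonneg_poly_op_norm_le(2)[OF poly_diff B(2)] by (intro add_mono Suc)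
    finally show ?case by (simp add: algebra_simps)
  qed simp
  have Y_conv: "convergent (\<lambda>n. Y n x)" for x
  proof (rule Cauchy_convergent, rule CauchyI')
    fix e :: real assume "e > 0"
    then have "e / (norm x + 1) > 0"
      by (simp add: add_nonneg_pos)
    then obtain N where N: "\<And>m n. m \<ge> N \<Longrightarrow> n \<ge> N \<Longrightarrow> norm (t m - t n) < e / (norm x + 1)"
      using CauchyD[OF convergent_Cauchy[OF \<open>convergent t\<close>]] by metis
    have "dist (Y m x) (Y n x) < e" if "m \<ge> N" "n > m" for m n
    proof -
      have "dist (Y m x) (Y n x) \<le> (t n - t m) * norm x"
        using Y_diff[of m "n - m" x] that by (simp add: dist_norm norm_minus_commute)
      also have "\<dots> \<le> (t n - t m) * (norm x + 1)"
        using \<open>incseq t\<close> that by (intro mult_left_mono) (auto simp: incseq_def)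
      also have "\<dots> < e"
        using N[of n m] that incseqD[OF \<open>incseq t\<close>, of m n]
        by (simp add: pos_less_divide_eq add_nonneg_pos)
      finally show ?thesis .
    qed
    then show "\<exists>N. \<forall>m\<ge>N. \<forall>n>m. dist (Y m x) (Y n x) < e" by blast
  qed
  define L where "L x = lim (\<lambda>n. Y n x)" for x
  have lim: "(\<lambda>n. Y n x) \<longlonglongrightarrow> L x" for x
    using Y_conv by (simp add: L_def convergent_LIMSEQ_iff)
  have Y_norm: "norm (Y n x) \<le> norm x" for n x
    using nonneg_poly_op_norm_le(2)[OF poly_Y B(2), of n x] t_le_1[of n]
      mult_right_mono[of "t n" 1 "norm x"] by simp
  have L_norm: "norm (L x) \<le> norm x" for x
    by (rule LIMSEQ_le_const2[OF tendsto_norm[OF lim]]) (use Y_norm in auto)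
  have L_lin: "bounded_clinear L"
  proof (rule bounded_clinearI)
    show "L (x + y) = L x + L y" for x y
      by (rule LIMSEQ_unique[OF lim], unfold bounded_clinear_add[OF Y_lin]) (intro tendsto_intros lim)
    show "L (c *\<^sub>C x) = c *\<^sub>C L x" for c x
      by (rule LIMSEQ_unique[OF lim], unfold bounded_clinear_scaleC[OF Y_lin])
        (intro tendsto_intros lim)
    show "norm (L x) \<le> 1 * norm x" for x
      using L_norm by simp
  qed
  have L_sa: "cinner (L x) y = cinner x (L y)" for x y
  proof (rule LIMSEQ_unique)
    show "(\<lambda>n. cinner (Y n x) y) \<longlonglongrightarrow> cinner (L x) y"
      by (intro tendsto_intros lim)
    show "(\<lambda>n. cinner (Y n x) y) \<longlonglongrightarrow> cinner x (L y)"
      unfolding nonneg_poly_op_selfadjoint[OF poly_Y B sa] by (intro tendsto_intros lim)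
  qed
  have L_comm: "C (L x) = L (C x)" if C: "bounded_clinear C" "\<And>x. C (B x) = B (C x)" for C x
  proof (rule LIMSEQ_unique[OF _ lim])
    show "(\<lambda>n. Y n (C x)) \<longlonglongrightarrow> C (L x)"
      using bounded_linear.tendsto[OF bounded_clinear_imp_bounded_linear[OF C(1)] lim]
      by (simp add: nonneg_poly_op_commute[OF poly_Y C])
  qed
  have L_eq: "L x = (1/2) *\<^sub>R (B x + L (L x))" for x
  proof (rule LIMSEQ_unique[OF LIMSEQ_Suc[OF lim]])
    have "(\<lambda>n. Y n (Y n x - L x)) \<longlonglongrightarrow> 0"
    proof (rule Lim_null_comparison)
      show "(\<lambda>n. norm (Y n x - L x)) \<longlonglongrightarrow> 0"
        by (rule tendsto_norm_zero) (rule LIM_zero[OF lim])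
    qed (use Y_norm in auto)
    from tendsto_add[OF this lim[of "L x"]] have "(\<lambda>n. Y n (Y n x)) \<longlonglongrightarrow> L (L x)"
      by (simp add: bounded_clinear_diff[OF Y_lin])
    then show "(\<lambda>n. Y (Suc n) x) \<longlonglongrightarrow> (1/2) *\<^sub>R (B x + L (L x))"
      unfolding Y_simps by (intro tendsto_intros)
  qed
  show ?thesis
  proof
    show "positive_op (\<lambda>x. x - L x)"
      unfolding positive_op_def
    proof
      show "bounded_clinear (\<lambda>x. x - L x)"
      proof (rule bounded_clinearI)
        show "norm (x - L x) \<le> 2 * norm x" for x
          using norm_triangle_ineq4[of x "L x"] L_norm[of x] by linarith
      qed (simp_all add: bounded_clinear_add[OF L_lin] bounded_clinear_scaleC[OF L_lin]
          complex_vector.scale_right_diff_distrib)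
      have "cinner (x - L x) x \<in> \<real>\<^sub>\<ge>\<^sub>0" for x
      proof -
        have "cnj (cinner (L x) x) = cinner (L x) x"
          using L_sa cinner_commute by metis
        then have "Im (cinner (L x) x) = 0"
          by (simp add: complex_eq_iff)
        moreover have "Re (cinner (L x) x) \<le> norm x * norm x"
          using complex_Re_le_cmod cmod_cinner_le[of "L x" x] L_norm[of x]
            mult_right_mono[of "norm (L x)" "norm x" "norm x"]
          by (meson norm_ge_zero order_trans)
        ultimately show ?thesis
          by (simp add: complex_nonneg_Reals_iff cinner_diff_left cinner_self power2_eq_square)
      qed
      then show "\<forall>x. cinner (x - L x) x \<in> \<real>\<^sub>\<ge>\<^sub>0" by blast
    qed
    show "x - L x - L (x - L x) = x - B x" for x
    proof -
      have "2 *\<^sub>R L x = B x + L (L x)"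
        by (subst L_eq) simp
      then show ?thesis
        by (simp add: bounded_clinear_diff[OF L_lin] scaleR_2 algebra_simps)
    qed
    show "C (x - L x) = C x - L (C x)" if "bounded_clinear C" "\<And>x. C (B x) = B (C x)" for C x
      using L_comm[OF that] by (simp add: bounded_clinear_diff[OF that(1)])
  qed
qed

lemma positive_op_bounded_clinear: "positive_op S \<Longrightarrow> bounded_clinear S"
  by (simp add: positive_op_def)

text \<open>Polarization: a sesquilinear form with real quadratic form is Hermitian.\<close>

lemma positive_op_selfadjoint:
  assumes S: "positive_op S"
  shows "cinner (S x) y = cinner x (S y)"
proof -
  note lin = positive_op_bounded_clinear[OF S]
  have real: "Im (cinner (S x) x) = 0" for x
    using S by (auto simp: positive_op_def complex_nonneg_Reals_iff)
  have *: "Im (cinner (S x) y) + Im (cinner (S y) x) = 0" for x y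
    using real[of "x + y"] real[of x] real[of y]
    by (simp add: bounded_clinear_add[OF lin] cinner_simps)
  have "Im (cinner (S x) y) = - Im (cinner (S y) x)"
    using *[of x y] by simp
  moreover have "Re (cinner (S x) y) = Re (cinner (S y) x)"
    using *[of "\<i> *\<^sub>C x" y] by (simp add: bounded_clinear_scaleC[OF lin] cinner_simps)
  ultimately show ?thesis
    by (subst (2) cinner_commute) (simp add: complex_eq_iff)
qed

text \<open>The quadratic inequality \<open>0 \<le> \<langle>S(x - r S x), x - r S x\<rangle>\<close> for all real \<open>r\<close> forces
  \<open>S x = 0\<close> when \<open>\<langle>S x, x\<rangle> = 0\<close>.\<close>

lemma positive_op_eq_zero:
  assumes S: "positive_op S" and zero: "cinner (S x) x = 0"
  shows "S x = 0"
proof (rule ccontr)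
  assume nz: "S x \<noteq> 0"
  note lin = positive_op_bounded_clinear[OF S]
  define b where "b = Re (cinner (S (S x)) (S x))"
  have b: "cinner (S (S x)) (S x) = of_real b" and "b \<ge> 0"
    using S by (auto simp: positive_op_def complex_nonneg_Reals_iff b_def complex_eq_iff)
  \<comment> \<open>Any small positive \<open>r\<close> would do; this one keeps \<open>r * b\<close> below \<open>\<parallel>S x\<parallel>\<^sup>2\<close>.\<close>
  define r where "r = (norm (S x))\<^sup>2 / (b + 1)"
  have r: "r > 0"
    using nz \<open>b \<ge> 0\<close> by (simp add: r_def)
  have "cinner (S (x - r *\<^sub>R S x)) (x - r *\<^sub>R S x) =
      of_real (r * (r * b) - 2 * (r * (norm (S x))\<^sup>2))"
    using zero b positive_op_selfadjoint[OF S, of "S x" x]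
    by (simp add: bounded_clinear_diff[OF lin] bounded_clinear_scaleR[OF lin] cinner_simps
        cinner_self algebra_simps)
  moreover have "Re (cinner (S (x - r *\<^sub>R S x)) (x - r *\<^sub>R S x)) \<ge> 0"
    using S by (auto simp: positive_op_def complex_nonneg_Reals_iff)
  ultimately have "r * (r * b) \<ge> r * (2 * (norm (S x))\<^sup>2)"
    by (simp only: Re_complex_of_real)
  then have "r * b \<ge> 2 * (norm (S x))\<^sup>2"
    using r by simp
  moreover have "r * b \<le> (norm (S x))\<^sup>2"
    using \<open>b \<ge> 0\<close> by (simp add: r_def divide_le_eq algebra_simps)
  moreover have "(norm (S x))\<^sup>2 > 0"
    using nz by simp
  ultimately show False by linarith
qed

text \<open>Two commuting positive square roots \<open>S\<close>, \<open>R\<close> of the same operator satisfy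
  \<open>(S + R)(S - R) = 0\<close>. So for \<open>y = (S - R) x\<close> the nonnegative numbers \<open>\<langle>S y, y\<rangle>\<close> and \<open>\<langle>R y, y\<rangle>\<close>
  add up to zero, which gives \<open>S y = R y = 0\<close>, and then \<open>\<parallel>y\<parallel>\<^sup>2 = \<langle>(S - R) y, x\<rangle> = 0\<close>.\<close>

lemma positive_sqrt_unique:
  assumes S: "positive_op S" and R: "positive_op R"
    and eq: "\<And>x. S (S x) = R (R x)" and comm: "\<And>x. R (S x) = S (R x)"
  shows "S = R"
proof
  fix x
  note lin = positive_op_bounded_clinear[OF S] positive_op_bounded_clinear[OF R]
  define y where "y = S x - R x"
  have "S y + R y = 0"
    by (simp add: y_def bounded_clinear_diff[OF lin(1)] bounded_clinear_diff[OF lin(2)] eq comm)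
  then have "cinner (S y) y + cinner (R y) y = 0"
    by (simp add: cinner_add_left[symmetric])
  moreover have "cinner (S y) y \<in> \<real>\<^sub>\<ge>\<^sub>0" "cinner (R y) y \<in> \<real>\<^sub>\<ge>\<^sub>0"
    using S R by (auto simp: positive_op_def)
  ultimately have "cinner (S y) y = 0" "cinner (R y) y = 0"
    by (auto simp: complex_nonneg_Reals_iff complex_eq_iff)
  then have "S y = 0" "R y = 0"
    using positive_op_eq_zero[OF S] positive_op_eq_zero[OF R] by auto
  then have "cinner y y = 0"
    using positive_op_selfadjoint[OF S, of y x] positive_op_selfadjoint[OF R, of y x]
    by (simp add: y_def cinner_diff_right)
  then show "S x = R x"
    by (simp add: y_def)
qed

text \<open>The constructed root commutes with every operator that commutes with \<open>B\<close>, in particular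
  with any other root, so the previous lemma identifies it with \<open>op_sqrt\<close>.\<close>

lemma op_sqrt_one_minus:
  fixes B :: "'a::chilbert_space \<Rightarrow> 'a"
  assumes B: "bounded_clinear B" "\<And>x. norm (B x) \<le> norm x"
    and sa: "\<And>x y. cinner (B x) y = cinner x (B y)"
  shows "positive_op (op_sqrt (\<lambda>x. x - B x))"
    and "op_sqrt (\<lambda>x. x - B x) (op_sqrt (\<lambda>x. x - B x) x) = x - B x"
proof -
  obtain S where S: "positive_op S" "\<And>x. S (S x) = x - B x"
    "\<And>C x. bounded_clinear C \<Longrightarrow> (\<And>x. C (B x) = B (C x)) \<Longrightarrow> C (S x) = S (C x)"
    using sqrt_one_minus_exists[OF B sa] by metis
  have "op_sqrt (\<lambda>x. x - B x) = S"
    unfolding op_sqrt_def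
  proof (rule the_equality)
    fix R assume R: "positive_op R \<and> R \<circ> R = (\<lambda>x. x - B x)"
    then have R': "R (R x) = x - B x" for x
      by (metis comp_apply)
    note lin = positive_op_bounded_clinear[OF conjunct1[OF R]]
    have "R (B x) = B (R x)" for x
      using R'[of "R x"] by (simp add: R' bounded_clinear_diff[OF lin])
    then show "R = S"
      using positive_sqrt_unique[of S R] S R R' lin by metis
  qed (use S in auto)
  then show "positive_op (op_sqrt (\<lambda>x. x - B x))"
    and "op_sqrt (\<lambda>x. x - B x) (op_sqrt (\<lambda>x. x - B x) x) = x - B x"
    using S by auto
qed

lemma
  assumes T: "contraction T"
  shows positive_op_defect_op: "positive_op (defect_op T)"
    and defect_op_square: "defect_op T (defect_op T x) = x - cadjoint T (T x)"
proof -
  note lin = contraction_bounded_clinear[OF T]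
    and lin' = contraction_bounded_clinear[OF contraction_cadjoint[OF T]]
  have norm: "norm (cadjoint T (T x)) \<le> norm x" for x
    using contraction_norm_le[OF contraction_cadjoint[OF T]] contraction_norm_le[OF T]
      order_trans by blast
  have B: "bounded_clinear (\<lambda>x. cadjoint T (T x))"
    by (rule bounded_clinearI[where K = 1])
      (simp_all add: norm bounded_clinear_add[OF lin] bounded_clinear_scaleC[OF lin]
        bounded_clinear_add[OF lin'] bounded_clinear_scaleC[OF lin'])
  have sa: "cinner (cadjoint T (T x)) y = cinner x (cadjoint T (T y))" for x y
    by (simp add: cinner_cadjoint_left[OF lin] cinner_cadjoint[OF lin])
  show "positive_op (defect_op T)" "defect_op T (defect_op T x) = x - cadjoint T (T x)"
    unfolding defect_op_def by (fact op_sqrt_one_minus[OF B norm sa])+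
qed

section \<open>Moments of stationary sequences\<close>

lemma cinner_sum_left: "cinner (\<Sum>i\<in>A. f i) x = (\<Sum>i\<in>A. cinner (f i) x)"
  and cinner_sum_right: "cinner x (\<Sum>i\<in>A. f i) = (\<Sum>i\<in>A. cinner x (f i))"
  for x :: "'a::complex_inner"
  by (induction A rule: infinite_finite_induct) (simp_all add: cinner_simps)

lemma cinner_sum_sum:
  "cinner (\<Sum>i\<in>A. f i) (\<Sum>j\<in>B. g j) = (\<Sum>i\<in>A. \<Sum>j\<in>B. cinner (f i) (g j))"
  for f :: "_ \<Rightarrow> 'a::complex_inner"
  unfolding cinner_sum_left unfolding cinner_sum_right ..

lemma sum_cis_roots_of_unity:
  assumes "N > 0"
  shows "(\<Sum>k<N. cis (2 * pi * real k * of_int m / real N)) = (if int N dvd m then of_nat N else 0)"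
proof -
  define z where "z = cis (2 * pi * of_int m / real N)"
  have pow: "cis (2 * pi * real k * of_int m / real N) = z ^ k" for k
    by (simp add: z_def Complex.DeMoivre mult_ac)
  have "z ^ N = cis (2 * pi * of_int m)"
    using assms by (simp add: z_def Complex.DeMoivre)
  then have zN: "z ^ N = 1"
    by (simp add: cis_multiple_2pi)
  show ?thesis
  proof (cases "int N dvd m")
    case True
    then obtain q where "m = int N * q" by blast
    then have "z = cis (2 * pi * of_int q)"
      unfolding z_def using assms by (intro arg_cong[of _ _ cis]) simp
    then have "z = 1"
      using cis_multiple_2pi[of "of_int q"] by simp
    then show ?thesis
      using True by (simp add: pow)
  next
    case False
    have "z \<noteq> 1"
    proof
      assume "z = 1"
      then have "exp (\<i> * of_real (2 * pi * of_int m / real N)) = 1"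
        by (simp add: z_def cis_conv_exp)
      then obtain q :: int where "2 * pi * of_int m / real N = of_int (2 * q) * pi"
        by (auto simp: exp_eq_1)
      then have "real_of_int m = of_int (q * int N)"
        using assms by (simp add: field_simps)
      then have "m = q * int N"
        by (simp only: of_int_eq_iff)
      then show False
        using False by simp
    qed
    then show ?thesis
      using False geometric_sum[of z N] by (simp add: pow zN)
  qed
qed

lemma stationary_shift:
  fixes e :: "int \<Rightarrow> 'a::complex_inner"
  assumes "\<And>m n. cinner (e (m + 1)) (e (n + 1)) = cinner (e m) (e n)"
  shows "cinner (e m) (e n) = cinner (e (m - n)) (e 0)"
proof -
  have "\<forall>m. cinner (e m) (e n) = cinner (e (m - n)) (e 0)"
  proof (induction n rule: int_induct[where k = 0])
    case (step1 i)
    then show ?case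
      using assms[of "_ - 1" i] by (metis diff_add_cancel diff_diff_eq2 diff_diff_add add.commute)
  next
    case (step2 i)
    then show ?case
      using assms[of _ "i - 1"] by (metis diff_add_cancel add_diff_eq diff_diff_eq2)
  qed simp
  then show ?thesis by blast
qed

text \<open>Averaging over the \<open>N\<close>-th roots of unity \<open>\<zeta>\<^sub>k\<close> with the weights
  \<open>\<parallel>\<Sum>\<^sub>j \<zeta>\<^sub>k\<^sup>-\<^sup>j e\<^sub>j\<parallel>\<^sup>2 / N\<^sup>2\<close>: orthogonality of the roots picks, for each \<open>l\<close>, the single index
  \<open>j \<equiv> n + l (mod N)\<close>. There is no wraparound for \<open>l < N - n\<close>, so for large \<open>N\<close>
  most terms equal the \<open>n\<close>-th moment.\<close>

lemma root_of_unity_moment: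
  fixes e :: "int \<Rightarrow> 'a::complex_inner"
  assumes stat: "\<And>m n. cinner (e (m + 1)) (e (n + 1)) = cinner (e m) (e n)" and N: "N > 0"
  defines "w \<equiv> \<lambda>k. (norm (\<Sum>j<N. cis (- (2 * pi * real k * real j / real N)) *\<^sub>C e (int j)))\<^sup>2
      / (real N)\<^sup>2"
  shows "(\<Sum>k<N. of_real (w k) * cis (2 * pi * real k * real n / real N)) =
    (\<Sum>l<N. cinner (e (int ((n + l) mod N) - int l)) (e 0)) / of_nat N"
proof -
  define c where "c m = cinner (e m) (e 0)" for m
  have w: "of_real (w k) = (\<Sum>j<N. \<Sum>l<N. cis (- (2 * pi * real k * real j / real N)) *
      cis (2 * pi * real k * real l / real N) * c (int j - int l)) / (of_nat N)\<^sup>2" for k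
    unfolding w_def of_real_divide cinner_self[symmetric] cinner_sum_sum
    by (simp add: cinner_simps cis_cnj c_def stationary_shift[of e "int _" "int _", OF stat] mult_ac)
  have "(\<Sum>k<N. of_real (w k) * cis (2 * pi * real k * real n / real N)) =
    (\<Sum>k<N. \<Sum>j<N. \<Sum>l<N. c (int j - int l) *
      cis (2 * pi * real k * of_int (int n + int l - int j) / real N)) / (of_nat N)\<^sup>2"
    unfolding w sum_divide_distrib sum_distrib_right
    by (intro sum.cong refl) (simp add: cis_mult diff_divide_distrib add_divide_distrib algebra_simps)
  also have "(\<Sum>k<N. \<Sum>j<N. \<Sum>l<N. c (int j - int l) *
      cis (2 * pi * real k * of_int (int n + int l - int j) / real N)) =
    (\<Sum>l<N. \<Sum>j<N. c (int j - int l) *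
      (\<Sum>k<N. cis (2 * pi * real k * of_int (int n + int l - int j) / real N)))"
    unfolding sum_distrib_left
    by (subst sum.swap, subst (2) sum.swap, subst sum.swap, rule refl)
  also have "\<dots> = (\<Sum>l<N. \<Sum>j<N. if j = (n + l) mod N then c (int j - int l) * of_nat N else 0)"
  proof (intro sum.cong refl)
    fix l j assume j: "j \<in> {..<N}"
    have "int N dvd int n + int l - int j \<longleftrightarrow> j = (n + l) mod N"
    proof -
      have "int N dvd int n + int l - int j \<longleftrightarrow> int (n + l) mod int N = int j mod int N"
        by (simp add: mod_eq_dvd_iff)
      also have "\<dots> \<longleftrightarrow> (n + l) mod N = j mod N"
        by (metis nat_int zmod_int)
      finally show ?thesis
        using j by auto
    qed
    then show "c (int j - int l) * (\<Sum>k<N. cis (2 * pi * real k * of_int (int n + int l - int j) / real N))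
      = (if j = (n + l) mod N then c (int j - int l) * of_nat N else 0)"
      by (simp only: sum_cis_roots_of_unity[OF N]) simp
  qed
  also have "\<dots> = (\<Sum>l<N. c (int ((n + l) mod N) - int l)) * of_nat N"
    using N by (simp add: sum.delta sum_distrib_right)
  finally show ?thesis
    using N by (simp add: c_def power2_eq_square)
qed

lemma circle_prob_measure_distr_cis:
  assumes "real_distribution M"
  shows "circle_prob_measure (distr M (restrict_space borel (sphere 0 1)) cis)"
    and "(\<integral>\<zeta>. \<zeta> ^ n \<partial>distr M (restrict_space borel (sphere 0 1)) cis) = char M (real n)"
proof -
  interpret real_distribution M by fact
  have "cis \<in> borel_measurable M"
    by (simp add: measurable_completion borel_measurable_continuous_onI continuous_on_cis
        cong: measurable_cong_sets)
  then have meas: "cis \<in> measurable M (restrict_space borel (sphere 0 1))"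
    by (intro measurable_restrict_space2) auto
  show "circle_prob_measure (distr M (restrict_space borel (sphere 0 1)) cis)"
    using prob_space_distr[OF meas] by (simp add: circle_prob_measure_def)
  have "(\<integral>\<zeta>. \<zeta> ^ n \<partial>distr M (restrict_space borel (sphere 0 1)) cis) = (\<integral>x. cis x ^ n \<partial>M)"
    by (rule integral_distr[OF meas], rule measurable_restrict_space1) simp
  also have "\<dots> = char M (real n)"
    unfolding char_def Complex.DeMoivre unfolding cis_conv_exp ..
  finally show "(\<integral>\<zeta>. \<zeta> ^ n \<partial>distr M (restrict_space borel (sphere 0 1)) cis) = char M (real n)" .
qed

text \<open>The theorem of Herglotz (Bochner's theorem for the integers). The measures on the roots of
  unity have moments converging to the prescribed ones, and their arguments lie in a bounded
  interval. So Helly's theorem gives a weak limit on the line, whose image under \<open>cis\<close> is the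
  measure sought: its moments are values of the characteristic function of the limit.\<close>

theorem herglotz_representation:
  fixes e :: "int \<Rightarrow> 'a::complex_inner"
  assumes stat: "\<And>m n. cinner (e (m + 1)) (e (n + 1)) = cinner (e m) (e n)"
    and norm0: "norm (e 0) = 1"
  obtains \<mu> where "circle_prob_measure \<mu>" "\<And>n. (\<integral>\<zeta>. \<zeta> powi n \<partial>\<mu>) = cinner (e n) (e 0)"
proof -
  define c where "c m = cinner (e m) (e 0)" for m
  have "norm (e m) = norm (e 0)" for m
    by (rule norm_eq_of_cinner_eq) (subst stationary_shift[of e, OF stat], simp)
  then have c_le: "cmod (c m) \<le> 1" for m
    using cmod_cinner_le[of "e m" "e 0"] by (simp add: c_def norm0)
  have c0: "c 0 = 1"
    by (simp add: c_def cinner_self norm0)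
  have c_neg: "c (- m) = cnj (c m)" for m
    using stationary_shift[of e 0 m, OF stat] by (simp add: c_def cinner_commute[of "e 0"])
  define w where "w N k = (norm (\<Sum>j<N. cis (- (2 * pi * real k * real j / real N)) *\<^sub>C e (int j)))\<^sup>2
      / (real N)\<^sup>2" for N k
  have moment: "(\<Sum>k<N. of_real (w N k) * cis (2 * pi * real k * real n / real N)) =
    (\<Sum>l<N. c (int ((n + l) mod N) - int l)) / of_nat N" if "N > 0" for N n
    unfolding w_def c_def by (rule root_of_unity_moment[where e = e, OF stat that])
  have w_nonneg: "w N k \<ge> 0" for N k
    by (simp add: w_def)
  have w_sum: "(\<Sum>k<N. w N k) = 1" if "N > 0" for N
  proof -
    have "complex_of_real (\<Sum>k<N. w N k) = 1"
      using moment[OF that, of 0] that by (simp add: c0)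
    then show ?thesis
      by (metis of_real_eq_1_iff)
  qed
  define f where "f i k = (if k < Suc i then w (Suc i) k else 0)" for i k
  define p where "p i = embed_pmf (f i)" for i
  have pmf_p: "pmf (p i) k = f i k" for i k
    unfolding p_def
  proof (rule pmf_embed_pmf)
    show "f i k \<ge> 0" for k
      by (simp add: f_def w_nonneg)
    have "(\<integral>\<^sup>+ k. ennreal (f i k) \<partial>count_space UNIV) = (\<Sum>k<Suc i. ennreal (f i k))"
      by (rule nn_integral_count_space') (auto simp: f_def)
    also have "\<dots> = (\<Sum>k<Suc i. ennreal (w (Suc i) k))"
      by (intro sum.cong) (auto simp: f_def)
    also have "\<dots> = ennreal (\<Sum>k<Suc i. w (Suc i) k)"
      by (rule sum_ennreal) (simp add: w_nonneg)
    finally show "(\<integral>\<^sup>+ k. ennreal (f i k) \<partial>count_space UNIV) = 1"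
      using w_sum[of "Suc i"] by simp
  qed
  have set_p: "k < Suc i" if "k \<in> set_pmf (p i)" for i k
    using that by (auto simp: set_pmf_iff pmf_p f_def split: if_splits)
  define M where "M i = distr (measure_pmf (p i)) borel (\<lambda>k. 2 * pi * real k / real (Suc i))" for i
  have distr: "real_distribution (M i)" for i
    unfolding M_def by (rule prob_space.real_distribution_distr[OF measure_pmf.prob_space_axioms]) simp
  have char_M: "char (M i) (real n) = (\<Sum>l<Suc i. c (int ((n + l) mod Suc i) - int l)) / of_nat (Suc i)"
    for i n
  proof -
    have "char (M i) (real n) =
        (\<integral>k. iexp (real n * (2 * pi * real k / real (Suc i))) \<partial>measure_pmf (p i))"
      unfolding char_def M_def by (rule integral_distr) auto
    also have "\<dots> = (\<Sum>k<Suc i. pmf (p i) k *\<^sub>R iexp (real n * (2 * pi * real k / real (Suc i))))"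
      by (rule integral_measure_pmf) (auto dest: set_p)
    also have "\<dots> = (\<Sum>k<Suc i. of_real (w (Suc i) k) * cis (2 * pi * real k * real n / real (Suc i)))"
      by (intro sum.cong refl)
        (simp add: pmf_p f_def scaleR_conv_of_real cis_conv_exp mult_ac)
    finally show ?thesis
      using moment[of "Suc i" n] by simp
  qed
  have char_lim: "(\<lambda>i. char (M i) (real n)) \<longlonglongrightarrow> c (int n)" for n
  proof (rule LIM_zero_cancel, rule Lim_null_comparison)
    show "(\<lambda>i. 2 * real n * inverse (real (Suc i))) \<longlonglongrightarrow> 0"
      using tendsto_mult_right_zero[OF LIMSEQ_inverse_real_of_nat] by simp
    show "\<forall>\<^sub>F i in sequentially. norm (char (M i) (real n) - c (int n)) \<le> 2 * real n * inverse (real (Suc i))"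
    proof (rule eventually_sequentiallyI[of n])
      fix i assume "i \<ge> n"
      define d where "d l = c (int ((n + l) mod Suc i) - int l) - c (int n)" for l
      have d0: "d l = 0" if "l < Suc i - n" for l
        using that \<open>i \<ge> n\<close> by (simp add: d_def)
      have d2: "cmod (d l) \<le> 2" for l
        using norm_triangle_ineq4[of "c (int ((n + l) mod Suc i) - int l)" "c (int n)"]
          c_le[of "int ((n + l) mod Suc i) - int l"] c_le[of "int n"]
        by (simp add: d_def)
      have "cmod (\<Sum>l<Suc i. d l) = cmod (\<Sum>l\<in>{Suc i - n..<Suc i}. d l)"
        by (rule arg_cong[of _ _ cmod], rule sum.mono_neutral_right) (auto intro: d0)
      also have "\<dots> \<le> (\<Sum>l\<in>{Suc i - n..<Suc i}. 2)"
        by (intro sum_norm_le d2)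
      also have "\<dots> = 2 * real n"
        using \<open>i \<ge> n\<close> by simp
      finally have "cmod ((\<Sum>l<Suc i. d l) / of_nat (Suc i)) \<le> 2 * real n * inverse (real (Suc i))"
        unfolding norm_divide norm_of_nat unfolding divide_inverse
        by (rule mult_right_mono) simp
      moreover have "(\<Sum>l<Suc i. d l) / of_nat (Suc i) = char (M i) (real n) - c (int n)"
        unfolding char_M d_def sum_subtractf diff_divide_distrib by (simp del: sum.lessThan_Suc of_nat_Suc)
      ultimately show "norm (char (M i) (real n) - c (int n)) \<le> 2 * real n * inverse (real (Suc i))"
        by simp
    qed
  qed
  \<comment> \<open>The arguments lie between \<open>0\<close> and \<open>2 \<pi> < 8\<close>.\<close>
  have mass: "1 - \<epsilon> < measure (M i) {-1<..8}" if "\<epsilon> > 0" for \<epsilon> :: real and i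
  proof -
    have "measure (M i) {-1<..8} = measure (measure_pmf (p i)) {k. 2 * pi * real k / real (Suc i) \<in> {-1<..8}}"
      unfolding M_def by (subst measure_distr) (auto simp: vimage_def)
    also have "\<dots> = 1"
    proof (rule measure_pmf.prob_eq_1[THEN iffD2])
      show "AE k in measure_pmf (p i). k \<in> {k. 2 * pi * real k / real (Suc i) \<in> {-1<..8}}"
        unfolding AE_measure_pmf_iff
      proof
        fix k assume "k \<in> set_pmf (p i)"
        then have k: "real k \<le> real (Suc i)"
          using set_p by fastforce
        have "2 * pi * real k \<le> 8 * real (Suc i)"
          using pi_less_4 k by (intro mult_mono) auto
        moreover have "0 \<le> 2 * pi * real k / real (Suc i)"
          by simp
        then have "-1 < 2 * pi * real k / real (Suc i)"
          by linarith
        ultimately show "k \<in> {k. 2 * pi * real k / real (Suc i) \<in> {-1<..8}}"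
          by (simp add: pos_divide_le_eq del: of_nat_Suc)
      qed
    qed simp
    finally show ?thesis
      using that by simp
  qed
  have "tight M"
    unfolding tight_def
  proof (intro conjI allI impI)
    fix \<epsilon> :: real assume "\<epsilon> > 0"
    then have "(-1 :: real) < 8 \<and> (\<forall>i. 1 - \<epsilon> < measure (M i) {-1<..8})"
      using mass by simp
    then show "\<exists>a b. a < b \<and> (\<forall>i. 1 - \<epsilon> < measure (M i) {a<..b})"
      by blast
  qed (rule distr)
  then obtain r M' where r: "strict_mono r" "real_distribution M'" "weak_conv_m (M \<circ> id \<circ> r) M'"
    using tight_imp_convergent_subsubsequence[of M id] by (auto simp: strict_mono_def)
  have char_M': "char M' (real n) = c (int n)" for n
  proof (rule LIMSEQ_unique)
    show "(\<lambda>i. char ((M \<circ> id \<circ> r) i) (real n)) \<longlonglongrightarrow> char M' (real n)"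
      by (rule levy_continuity1[OF _ r(2,3)]) (simp add: distr)
    show "(\<lambda>i. char ((M \<circ> id \<circ> r) i) (real n)) \<longlonglongrightarrow> c (int n)"
      using LIMSEQ_subseq_LIMSEQ[OF char_lim r(1)] by (simp add: o_def)
  qed
  define \<mu> where "\<mu> = distr M' (restrict_space borel (sphere 0 1)) cis"
  have "circle_prob_measure \<mu>"
    unfolding \<mu>_def by (rule circle_prob_measure_distr_cis[OF r(2)])
  have nat_moment: "(\<integral>\<zeta>. \<zeta> ^ n \<partial>\<mu>) = c (int n)" for n
    unfolding \<mu>_def circle_prob_measure_distr_cis(2)[OF r(2)] by (rule char_M')
  have "(\<integral>\<zeta>. \<zeta> powi n \<partial>\<mu>) = c n" for n
  proof (cases "n \<ge> 0")
    case True
    then show ?thesis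
      using nat_moment[of "nat n"] by (simp add: power_int_def)
  next
    case False
    have "(\<integral>\<zeta>. \<zeta> powi n \<partial>\<mu>) = (\<integral>\<zeta>. cnj (\<zeta> ^ nat (- n)) \<partial>\<mu>)"
    proof (rule Bochner_Integration.integral_cong[OF refl])
      fix \<zeta> assume "\<zeta> \<in> space \<mu>"
      then have "cmod \<zeta> = 1"
        by (simp add: \<mu>_def space_restrict_space)
      then have "inverse \<zeta> = cnj \<zeta>"
        by (rule unimodular_inverse)
      then show "\<zeta> powi n = cnj (\<zeta> ^ nat (- n))"
        using False by (simp add: power_int_def)
    qed
    also have "\<dots> = cnj (c (- n))"
      using nat_moment[of "nat (- n)"] False by (subst Bochner_Integration.integral_cnj) simp
    finally show ?thesis
      by (simp add: c_neg)
  qed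
  then show ?thesis
    using that \<open>circle_prob_measure \<mu>\<close> by (auto simp: c_def)
qed

section \<open>Square-integrable functions on the circle\<close>

locale circle_measure =
  fixes \<mu> :: "complex measure"
  assumes circle_prob_measure: "circle_prob_measure \<mu>"
begin

sublocale prob_space \<mu>
  using circle_prob_measure by (simp add: circle_prob_measure_def)

lemma sets_eq: "sets \<mu> = sets (restrict_space borel (sphere 0 1))"
  using circle_prob_measure by (simp add: circle_prob_measure_def)

lemma space_eq: "space \<mu> = sphere 0 1"
  using sets_eq_imp_space_eq[OF sets_eq] by (simp add: space_restrict_space)

lemma measurable_of_borel: "f \<in> borel_measurable borel \<Longrightarrow> f \<in> borel_measurable \<mu>"
  unfolding measurable_cong_sets[OF sets_eq refl] by (rule measurable_restrict_space1)

lemma id_measurable [measurable]: "(\<lambda>\<zeta>. \<zeta>) \<in> borel_measurable \<mu>"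
  by (rule measurable_of_borel) simp

lemma powi_measurable [measurable]: "(\<lambda>\<zeta>. \<zeta> powi n) \<in> borel_measurable \<mu>"
  unfolding power_int_def by measurable

lemma cnj_measurable [measurable (raw)]:
  "f \<in> borel_measurable M \<Longrightarrow> (\<lambda>x. cnj (f x)) \<in> borel_measurable M"
  by (rule borel_measurable_continuous_on[of cnj]) (auto intro: continuous_intros)

lemma powi_unimodular: "\<zeta> \<in> space \<mu> \<Longrightarrow> cmod (\<zeta> powi n) = 1"
  by (simp add: space_eq norm_power_int)

lemma cnj_powi: "\<zeta> \<in> space \<mu> \<Longrightarrow> cnj (\<zeta> powi n) = \<zeta> powi (- n)"
  using powi_unimodular[of \<zeta> n]
  by (simp add: power_int_minus unimodular_inverse)

lemma L2_I:
  "f \<in> borel_measurable \<mu> \<Longrightarrow> integrable \<mu> (\<lambda>\<zeta>. (cmod (f \<zeta>))\<^sup>2) \<Longrightarrow> f \<in> L2 \<mu>"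
  by (simp add: L2_def)

lemma L2_measurable [measurable_dest]: "f \<in> L2 \<mu> \<Longrightarrow> f \<in> borel_measurable \<mu>"
  and L2_integrable_square: "f \<in> L2 \<mu> \<Longrightarrow> integrable \<mu> (\<lambda>\<zeta>. (cmod (f \<zeta>))\<^sup>2)"
  by (simp_all add: L2_def)

lemma L2_bounded:
  assumes [measurable]: "f \<in> borel_measurable \<mu>" and "\<And>\<zeta>. \<zeta> \<in> space \<mu> \<Longrightarrow> cmod (f \<zeta>) \<le> B"
  shows "f \<in> L2 \<mu>"
proof (rule L2_I)
  show "integrable \<mu> (\<lambda>\<zeta>. (cmod (f \<zeta>))\<^sup>2)"
    by (rule integrable_const_bound[of _ "B\<^sup>2"]) (auto intro!: AE_I2 power_mono assms)
qed fact

lemma L2_const: "(\<lambda>_. c) \<in> L2 \<mu>"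
  by (rule L2_bounded[where B = "cmod c"]) auto

lemma L2_powi: "(\<lambda>\<zeta>. \<zeta> powi n) \<in> L2 \<mu>"
  by (rule L2_bounded[where B = 1]) (auto simp: powi_unimodular)

lemma L2_add:
  assumes "f \<in> L2 \<mu>" "g \<in> L2 \<mu>"
  shows "(\<lambda>\<zeta>. f \<zeta> + g \<zeta>) \<in> L2 \<mu>"
proof (rule L2_I)
  note [measurable] = assms[THEN L2_measurable]
  show "(\<lambda>\<zeta>. f \<zeta> + g \<zeta>) \<in> borel_measurable \<mu>" by measurable
  have sq: "(cmod (x + y))\<^sup>2 \<le> 2 * (cmod x)\<^sup>2 + 2 * (cmod y)\<^sup>2" for x y
  proof -
    have "(cmod (x + y))\<^sup>2 \<le> (cmod x + cmod y)\<^sup>2"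
      by (intro power_mono norm_triangle_ineq) simp
    then show ?thesis
      using sum_squares_bound[of "cmod x" "cmod y"] by (simp add: power2_sum)
  qed
  show "integrable \<mu> (\<lambda>\<zeta>. (cmod (f \<zeta> + g \<zeta>))\<^sup>2)"
    by (rule Bochner_Integration.integrable_bound[of \<mu> "\<lambda>\<zeta>. 2 * (cmod (f \<zeta>))\<^sup>2 + 2 * (cmod (g \<zeta>))\<^sup>2"])
      (auto intro!: AE_I2 sq L2_integrable_square assms Bochner_Integration.integrable_add
        Bochner_Integration.integrable_mult_right)
qed

lemma L2_mult_bounded:
  assumes "f \<in> L2 \<mu>" and [measurable]: "u \<in> borel_measurable \<mu>"
    and "\<And>\<zeta>. \<zeta> \<in> space \<mu> \<Longrightarrow> cmod (u \<zeta>) \<le> B"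
  shows "(\<lambda>\<zeta>. u \<zeta> * f \<zeta>) \<in> L2 \<mu>"
proof (rule L2_I)
  note [measurable] = assms(1)[THEN L2_measurable]
  show "(\<lambda>\<zeta>. u \<zeta> * f \<zeta>) \<in> borel_measurable \<mu>" by measurable
  have u_le: "(cmod (u \<zeta>))\<^sup>2 \<le> B\<^sup>2" if "\<zeta> \<in> space \<mu>" for \<zeta>
    by (intro power_mono assms that) simp
  show "integrable \<mu> (\<lambda>\<zeta>. (cmod (u \<zeta> * f \<zeta>))\<^sup>2)"
  proof (rule Bochner_Integration.integrable_bound[of \<mu> "\<lambda>\<zeta>. B\<^sup>2 * (cmod (f \<zeta>))\<^sup>2"])
    show "AE \<zeta> in \<mu>. norm ((cmod (u \<zeta> * f \<zeta>))\<^sup>2) \<le> norm (B\<^sup>2 * (cmod (f \<zeta>))\<^sup>2)"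
      using mult_right_mono[OF u_le] by (intro AE_I2) (simp add: norm_mult power_mult_distrib)
  qed (use L2_integrable_square[OF assms(1)] in simp_all)
qed

lemma L2_cmult: "f \<in> L2 \<mu> \<Longrightarrow> (\<lambda>\<zeta>. c * f \<zeta>) \<in> L2 \<mu>"
  by (rule L2_mult_bounded[where B = "cmod c"]) auto

lemma L2_diff: "f \<in> L2 \<mu> \<Longrightarrow> g \<in> L2 \<mu> \<Longrightarrow> (\<lambda>\<zeta>. f \<zeta> - g \<zeta>) \<in> L2 \<mu>"
  using L2_add[OF _ L2_cmult[of g "-1"]] by simp

lemma L2_mult_ident: "f \<in> L2 \<mu> \<Longrightarrow> (\<lambda>\<zeta>. \<zeta> * f \<zeta>) \<in> L2 \<mu>"
  by (rule L2_mult_bounded[where B = 1]) (auto simp: space_eq)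

lemma L2_inner_integrable:
  assumes "f \<in> L2 \<mu>" "g \<in> L2 \<mu>"
  shows "integrable \<mu> (\<lambda>\<zeta>. f \<zeta> * cnj (g \<zeta>))"
proof -
  note [measurable] = assms[THEN L2_measurable]
  have le: "cmod x * cmod y \<le> (cmod x)\<^sup>2 + (cmod y)\<^sup>2" for x y
  proof -
    have "0 \<le> cmod x * cmod y" by simp
    then show ?thesis
      using sum_squares_bound[of "cmod x" "cmod y"] by linarith
  qed
  show ?thesis
    by (rule Bochner_Integration.integrable_bound[of \<mu> "\<lambda>\<zeta>. (cmod (f \<zeta>))\<^sup>2 + (cmod (g \<zeta>))\<^sup>2"])
      (auto intro!: AE_I2 le L2_integrable_square assms Bochner_Integration.integrable_add
        simp: norm_mult)
qed

lemma L2_integrable: "f \<in> L2 \<mu> \<Longrightarrow> integrable \<mu> f"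
  using L2_inner_integrable[OF _ L2_const[of 1]] by simp

lemma L2_inner_cnj: "L2_inner \<mu> g f = cnj (L2_inner \<mu> f g)"
  unfolding L2_inner_def by (subst Bochner_Integration.integral_cnj[symmetric]) (simp add: mult.commute)

lemma L2_inner_add_left:
  "f \<in> L2 \<mu> \<Longrightarrow> g \<in> L2 \<mu> \<Longrightarrow> h \<in> L2 \<mu> \<Longrightarrow>
    L2_inner \<mu> (\<lambda>\<zeta>. f \<zeta> + g \<zeta>) h = L2_inner \<mu> f h + L2_inner \<mu> g h"
  by (simp add: L2_inner_def distrib_right L2_inner_integrable)

lemma L2_inner_diff_left:
  "f \<in> L2 \<mu> \<Longrightarrow> g \<in> L2 \<mu> \<Longrightarrow> h \<in> L2 \<mu> \<Longrightarrow>
    L2_inner \<mu> (\<lambda>\<zeta>. f \<zeta> - g \<zeta>) h = L2_inner \<mu> f h - L2_inner \<mu> g h"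
  by (simp add: L2_inner_def left_diff_distrib L2_inner_integrable)

lemma L2_inner_diff_right:
  "f \<in> L2 \<mu> \<Longrightarrow> g \<in> L2 \<mu> \<Longrightarrow> h \<in> L2 \<mu> \<Longrightarrow>
    L2_inner \<mu> h (\<lambda>\<zeta>. f \<zeta> - g \<zeta>) = L2_inner \<mu> h f - L2_inner \<mu> h g"
  by (simp add: L2_inner_def right_diff_distrib L2_inner_integrable)

lemma L2_inner_add_right:
  "f \<in> L2 \<mu> \<Longrightarrow> g \<in> L2 \<mu> \<Longrightarrow> h \<in> L2 \<mu> \<Longrightarrow>
    L2_inner \<mu> h (\<lambda>\<zeta>. f \<zeta> + g \<zeta>) = L2_inner \<mu> h f + L2_inner \<mu> h g"
  by (simp add: L2_inner_def distrib_left L2_inner_integrable)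

lemma L2_inner_cmult_left: "L2_inner \<mu> (\<lambda>\<zeta>. c * f \<zeta>) g = c * L2_inner \<mu> f g"
  by (simp add: L2_inner_def mult.assoc)

lemma L2_inner_cmult_right: "L2_inner \<mu> g (\<lambda>\<zeta>. c * f \<zeta>) = cnj c * L2_inner \<mu> g f"
  by (simp add: L2_inner_def mult.left_commute)

lemma L2_inner_cong_AE:
  assumes "AE \<zeta> in \<mu>. f \<zeta> = f' \<zeta>" "AE \<zeta> in \<mu>. g \<zeta> = g' \<zeta>"
    and "f \<in> L2 \<mu>" "f' \<in> L2 \<mu>" "g \<in> L2 \<mu>" "g' \<in> L2 \<mu>"
  shows "L2_inner \<mu> f g = L2_inner \<mu> f' g'"
proof -
  note [measurable] = assms(3-6)[THEN L2_measurable]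
  show ?thesis
    unfolding L2_inner_def using assms(1,2) by (intro integral_cong_AE) auto
qed

lemma L2_inner_self: "L2_inner \<mu> f f = of_real (\<integral>\<zeta>. (cmod (f \<zeta>))\<^sup>2 \<partial>\<mu>)"
  by (simp add: L2_inner_def complex_norm_square[symmetric] del: of_real_power)

lemma L2_inner_self_eq_0:
  assumes "f \<in> L2 \<mu>" "L2_inner \<mu> f f = 0"
  shows "AE \<zeta> in \<mu>. f \<zeta> = 0"
proof -
  have "(\<integral>\<zeta>. (cmod (f \<zeta>))\<^sup>2 \<partial>\<mu>) = 0"
    using assms(2) by (simp add: L2_inner_self)
  then show ?thesis
    using integral_nonneg_eq_0_iff_AE[OF L2_integrable_square[OF assms(1)]] by simp
qed

lemma L2_Cauchy_Schwarz:
  assumes "f \<in> L2 \<mu>" "g \<in> L2 \<mu>"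
  shows "(cmod (L2_inner \<mu> f g))\<^sup>2 \<le> (\<integral>\<zeta>. (cmod (f \<zeta>))\<^sup>2 \<partial>\<mu>) * (\<integral>\<zeta>. (cmod (g \<zeta>))\<^sup>2 \<partial>\<mu>)"
proof -
  note [measurable] = assms[THEN L2_measurable]
  have int: "integrable \<mu> (\<lambda>\<zeta>. cmod (f \<zeta>) * cmod (g \<zeta>))"
    using integrable_norm[OF L2_inner_integrable[OF assms]] by (simp add: norm_mult)
  have nn: "(\<integral>\<^sup>+\<zeta>. ennreal ((cmod (h \<zeta>))\<^sup>2) \<partial>\<mu>) = ennreal (\<integral>\<zeta>. (cmod (h \<zeta>))\<^sup>2 \<partial>\<mu>)" if "h \<in> L2 \<mu>" for h
    using nn_integral_eq_integral[OF L2_integrable_square[OF that]] by simp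
  have "(\<integral>\<^sup>+\<zeta>. ennreal (cmod (f \<zeta>)) * ennreal (cmod (g \<zeta>)) \<partial>\<mu>) =
      ennreal (\<integral>\<zeta>. cmod (f \<zeta>) * cmod (g \<zeta>) \<partial>\<mu>)"
    using nn_integral_eq_integral[OF int] by (simp add: ennreal_mult)
  then have "ennreal ((\<integral>\<zeta>. cmod (f \<zeta>) * cmod (g \<zeta>) \<partial>\<mu>)\<^sup>2) \<le>
      ennreal ((\<integral>\<zeta>. (cmod (f \<zeta>))\<^sup>2 \<partial>\<mu>) * (\<integral>\<zeta>. (cmod (g \<zeta>))\<^sup>2 \<partial>\<mu>))"
    using Cauchy_Schwarz_nn_integral[of "\<lambda>\<zeta>. ennreal (cmod (f \<zeta>))" \<mu> "\<lambda>\<zeta>. ennreal (cmod (g \<zeta>))"]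
    by (simp add: nn assms ennreal_power ennreal_mult)
  then have "(\<integral>\<zeta>. cmod (f \<zeta>) * cmod (g \<zeta>) \<partial>\<mu>)\<^sup>2 \<le>
      (\<integral>\<zeta>. (cmod (f \<zeta>))\<^sup>2 \<partial>\<mu>) * (\<integral>\<zeta>. (cmod (g \<zeta>))\<^sup>2 \<partial>\<mu>)"
    by (subst (asm) ennreal_le_iff) auto
  moreover have "cmod (L2_inner \<mu> f g) \<le> (\<integral>\<zeta>. cmod (f \<zeta>) * cmod (g \<zeta>) \<partial>\<mu>)"
    using integral_norm_bound[of \<mu> "\<lambda>\<zeta>. f \<zeta> * cnj (g \<zeta>)"] by (simp add: L2_inner_def norm_mult)
  ultimately show ?thesis
    using power_mono[of "cmod (L2_inner \<mu> f g)" _ 2] norm_ge_zero order_trans by blast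
qed

section \<open>Uniqueness of Fourier coefficients\<close>

lemma integrable_mult_bounded:
  fixes u p :: "complex \<Rightarrow> complex"
  assumes "integrable \<mu> u" and [measurable]: "p \<in> borel_measurable \<mu>"
    and "\<And>\<zeta>. \<zeta> \<in> space \<mu> \<Longrightarrow> cmod (p \<zeta>) \<le> B"
  shows "integrable \<mu> (\<lambda>\<zeta>. u \<zeta> * p \<zeta>)"
proof (rule Bochner_Integration.integrable_bound[of _ "\<lambda>\<zeta>. B * norm (u \<zeta>)"])
  note [measurable] = borel_measurable_integrable[OF assms(1)]
  show "(\<lambda>\<zeta>. u \<zeta> * p \<zeta>) \<in> borel_measurable \<mu>" by measurable
  have "cmod (p \<zeta>) \<le> \<bar>B\<bar>" if "\<zeta> \<in> space \<mu>" for \<zeta>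
    using assms(3)[OF that] by simp
  then show "AE \<zeta> in \<mu>. norm (u \<zeta> * p \<zeta>) \<le> norm (B * norm (u \<zeta>))"
    by (auto intro!: AE_I2 mult_right_mono simp: norm_mult abs_mult mult.commute[of "cmod (u _)"])
qed (use assms(1) in auto)

lemma integrable_mult_continuous:
  assumes "integrable \<mu> (u :: complex \<Rightarrow> complex)" and p: "continuous_on UNIV (p :: complex \<Rightarrow> complex)"
  shows "integrable \<mu> (\<lambda>\<zeta>. u \<zeta> * p \<zeta>)"
proof -
  have "compact (p ` sphere 0 1)"
    by (intro compact_continuous_image continuous_on_subset[OF p]) auto
  then obtain B where "\<And>\<zeta>. \<zeta> \<in> sphere 0 1 \<Longrightarrow> cmod (p \<zeta>) \<le> B"
    using compact_imp_bounded by (force simp: bounded_iff)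
  then show ?thesis
    using assms(1) borel_measurable_continuous_onI[OF p]
    by (intro integrable_mult_bounded[where B = B] measurable_of_borel) (auto simp: space_eq)
qed

lemma continuous_on_of_real_polynomial:
  "real_polynomial_function p \<Longrightarrow> continuous_on UNIV (\<lambda>\<zeta>::complex. complex_of_real (p \<zeta>))"
  by (intro continuous_intros continuous_on_polymonial_function) (simp add: real_polynomial_function_eq)

lemma integrable_mult_polynomial:
  "integrable \<mu> (u :: complex \<Rightarrow> complex) \<Longrightarrow> real_polynomial_function p \<Longrightarrow>
    integrable \<mu> (\<lambda>\<zeta>. u \<zeta> * of_real (p \<zeta>))"
  by (erule integrable_mult_continuous) (erule continuous_on_of_real_polynomial)

lemma integrable_mult_powi:
  "integrable \<mu> (u :: complex \<Rightarrow> complex) \<Longrightarrow> integrable \<mu> (\<lambda>\<zeta>. u \<zeta> * \<zeta> powi n)"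
  by (rule integrable_mult_bounded[where B = 1]) (auto simp: powi_unimodular)

text \<open>On the circle a real linear function of \<open>\<zeta>\<close> is a combination of \<open>\<zeta>\<close> and \<open>\<zeta>\<^sup>-\<^sup>1\<close>, so
  multiplication by it only shifts and combines Fourier coefficients. Stating
  the claim for all \<open>u\<close> at once makes it stable under products.\<close>

lemma fourier_zero_times_polynomial:
  assumes "real_polynomial_function (p :: complex \<Rightarrow> real)"
    and "integrable \<mu> u" and "\<And>n. (\<integral>\<zeta>. u \<zeta> * \<zeta> powi n \<partial>\<mu>) = 0"
  shows "(\<integral>\<zeta>. u \<zeta> * of_real (p \<zeta>) * \<zeta> powi n \<partial>\<mu>) = 0"
  using assms
proof (induction arbitrary: u n)
  case (linear f)
  interpret f: bounded_linear f by fact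
  define w where "w = Complex (f 1 / 2) (- f \<i> / 2)"
  have eq: "u \<zeta> * of_real (f \<zeta>) * \<zeta> powi n =
      w * (u \<zeta> * \<zeta> powi (n + 1)) + cnj w * (u \<zeta> * \<zeta> powi (n - 1))" if "\<zeta> \<in> space \<mu>" for \<zeta>
  proof -
    have "\<zeta> \<noteq> 0"
      using that by (auto simp: space_eq)
    have "f \<zeta> = f (Re \<zeta> *\<^sub>R 1 + Im \<zeta> *\<^sub>R \<i>)"
      by (rule arg_cong[of _ _ f]) (simp add: complex_eq_iff)
    then have "complex_of_real (f \<zeta>) = w * \<zeta> + cnj w * cnj \<zeta>"
      by (simp add: f.add f.scaleR w_def complex_eq_iff algebra_simps)
    also have "cnj \<zeta> = \<zeta> powi (- 1)"
      using cnj_powi[OF that, of 1] by simp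
    finally have "u \<zeta> * of_real (f \<zeta>) * \<zeta> powi n =
        w * (u \<zeta> * (\<zeta> powi n * \<zeta>)) + cnj w * (u \<zeta> * (\<zeta> powi n * \<zeta> powi (- 1)))"
      by (simp only: algebra_simps)
    then show ?thesis
      using power_int_add[of \<zeta> n 1] power_int_add[of \<zeta> n "- 1"] \<open>\<zeta> \<noteq> 0\<close> by simp
  qed
  have "(\<integral>\<zeta>. u \<zeta> * of_real (f \<zeta>) * \<zeta> powi n \<partial>\<mu>) =
      (\<integral>\<zeta>. w * (u \<zeta> * \<zeta> powi (n + 1)) + cnj w * (u \<zeta> * \<zeta> powi (n - 1)) \<partial>\<mu>)"
    by (rule Bochner_Integration.integral_cong[OF refl]) (rule eq)
  also have "\<dots> = 0"
    using integrable_mult_powi[OF linear(2)] linear(3) by simp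
  finally show ?case .
next
  case (const c)
  then show ?case
    using const(2) by (simp add: mult.commute[of _ "complex_of_real c"] mult.assoc)
next
  case (add f g)
  have "(\<integral>\<zeta>. u \<zeta> * of_real (f \<zeta> + g \<zeta>) * \<zeta> powi n \<partial>\<mu>) =
      (\<integral>\<zeta>. u \<zeta> * of_real (f \<zeta>) * \<zeta> powi n + u \<zeta> * of_real (g \<zeta>) * \<zeta> powi n \<partial>\<mu>)"
    by (simp add: algebra_simps)
  also have "\<dots> = 0"
    using add integrable_mult_powi[OF integrable_mult_polynomial[OF add(5)]] by simp
  finally show ?case .
next
  case (mult f g)
  have "(\<integral>\<zeta>. (u \<zeta> * of_real (f \<zeta>)) * of_real (g \<zeta>) * \<zeta> powi n \<partial>\<mu>) = 0"
    by (intro mult.IH(2) integrable_mult_polynomial mult.hyps mult.IH(1) mult.prems)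
  then show ?case
    by (simp add: mult.assoc)
qed

text \<open>By Stone-Weierstrass, real polynomials in the real and imaginary parts of \<open>\<zeta>\<close> approximate \<open>\<phi>\<close>
  uniformly on the circle, and the error is paid for by \<open>\<integral>|u| d\<mu>\<close>.\<close>

lemma fourier_zero_times_continuous:
  assumes "integrable \<mu> u" "\<And>n. (\<integral>\<zeta>. u \<zeta> * \<zeta> powi n \<partial>\<mu>) = 0"
    and \<phi>: "continuous_on UNIV (\<phi> :: complex \<Rightarrow> real)"
  shows "(\<integral>\<zeta>. u \<zeta> * of_real (\<phi> \<zeta>) \<partial>\<mu>) = 0"
proof -
  have int\<phi>: "integrable \<mu> (\<lambda>\<zeta>. u \<zeta> * of_real (\<phi> \<zeta>))"
    by (rule integrable_mult_continuous[OF assms(1)]) (intro continuous_intros \<phi>)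
  define K where "K = (\<integral>\<zeta>. cmod (u \<zeta>) \<partial>\<mu>)"
  have bound: "cmod (\<integral>\<zeta>. u \<zeta> * of_real (\<phi> \<zeta>) \<partial>\<mu>) \<le> \<epsilon> * K" if "\<epsilon> > 0" for \<epsilon>
  proof -
    obtain p where p: "real_polynomial_function p" "\<And>\<zeta>. \<zeta> \<in> sphere 0 1 \<Longrightarrow> \<bar>\<phi> \<zeta> - p \<zeta>\<bar> < \<epsilon>"
      by (rule Stone_Weierstrass_real_polynomial_function[of "sphere 0 1" \<phi> \<epsilon>])
        (use continuous_on_subset[OF \<phi>] \<open>\<epsilon> > 0\<close> in auto)
    have intp: "integrable \<mu> (\<lambda>\<zeta>. u \<zeta> * of_real (p \<zeta>))"
      by (rule integrable_mult_polynomial[OF assms(1) p(1)])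
    have "(\<integral>\<zeta>. u \<zeta> * of_real (p \<zeta>) \<partial>\<mu>) = 0"
      using fourier_zero_times_polynomial[OF p(1) assms(1,2), of 0] by simp
    then have "(\<integral>\<zeta>. u \<zeta> * of_real (\<phi> \<zeta>) \<partial>\<mu>) = (\<integral>\<zeta>. u \<zeta> * of_real (\<phi> \<zeta>) - u \<zeta> * of_real (p \<zeta>) \<partial>\<mu>)"
      using int\<phi> intp by simp
    also have "cmod \<dots> \<le> (\<integral>\<zeta>. \<epsilon> * cmod (u \<zeta>) \<partial>\<mu>)"
    proof (rule Bochner_Integration.integral_norm_bound_integral)
      show "cmod (u \<zeta> * of_real (\<phi> \<zeta>) - u \<zeta> * of_real (p \<zeta>)) \<le> \<epsilon> * cmod (u \<zeta>)" if "\<zeta> \<in> space \<mu>" for \<zeta>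
      proof -
        have "cmod (u \<zeta> * of_real (\<phi> \<zeta>) - u \<zeta> * of_real (p \<zeta>)) = cmod (u \<zeta>) * \<bar>\<phi> \<zeta> - p \<zeta>\<bar>"
          by (simp only: right_diff_distrib[symmetric] of_real_diff[symmetric] norm_mult norm_of_real)
        also have "\<dots> \<le> cmod (u \<zeta>) * \<epsilon>"
          using p(2)[of \<zeta>] that by (intro mult_left_mono) (auto simp: space_eq)
        finally show ?thesis by (simp add: mult.commute)
      qed
    qed (use int\<phi> intp assms(1) in auto)
    finally show ?thesis
      by (simp add: K_def)
  qed
  have "K \<ge> 0"
    by (simp add: K_def)
  have "cmod (\<integral>\<zeta>. u \<zeta> * of_real (\<phi> \<zeta>) \<partial>\<mu>) \<le> 0 + \<epsilon>" if "\<epsilon> > 0" for \<epsilon>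
  proof -
    have "K + 1 > 0"
      using \<open>K \<ge> 0\<close> by linarith
    have "cmod (\<integral>\<zeta>. u \<zeta> * of_real (\<phi> \<zeta>) \<partial>\<mu>) \<le> \<epsilon> / (K + 1) * K"
      by (rule bound[OF divide_pos_pos[OF that \<open>K + 1 > 0\<close>]])
    also have "\<dots> \<le> \<epsilon> / (K + 1) * (K + 1)"
      using \<open>K + 1 > 0\<close> that by (intro mult_left_mono) simp_all
    also have "\<dots> = 0 + \<epsilon>"
      using \<open>K + 1 > 0\<close> by simp
    finally show ?thesis .
  qed
  then have "cmod (\<integral>\<zeta>. u \<zeta> * of_real (\<phi> \<zeta>) \<partial>\<mu>) \<le> 0"
    by (rule field_le_epsilon)
  then show ?thesis by simp
qed

text \<open>The indicator of a closed set is the decreasing pointwise limit of the continuous functions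
  \<open>max 0 (1 - k dist(\<zeta>, C))\<close>.\<close>

lemma fourier_zero_on_closed:
  assumes "integrable \<mu> u" "\<And>n. (\<integral>\<zeta>. u \<zeta> * \<zeta> powi n \<partial>\<mu>) = 0" and C: "closed C"
  shows "(\<integral>\<zeta>. indicator C \<zeta> *\<^sub>R u \<zeta> \<partial>\<mu>) = 0"
proof (cases "C = {}")
  case False
  define \<phi> where "\<phi> k \<zeta> = max 0 (1 - real k * infdist \<zeta> C)" for k and \<zeta> :: complex
  have cont: "continuous_on UNIV (\<phi> k)" for k
    unfolding \<phi>_def by (intro continuous_intros)
  note [measurable] = borel_measurable_integrable[OF assms(1)]
  have [measurable]: "\<phi> k \<in> borel_measurable \<mu>" for k
    by (rule measurable_of_borel[OF borel_measurable_continuous_onI[OF cont]])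
  have [measurable]: "(\<lambda>\<zeta>. indicator C \<zeta> :: real) \<in> borel_measurable \<mu>"
    by (rule measurable_of_borel) (rule borel_measurable_indicator[OF borel_closed[OF C]])
  have "(\<lambda>k. \<integral>\<zeta>. u \<zeta> * of_real (\<phi> k \<zeta>) \<partial>\<mu>) \<longlonglongrightarrow> (\<integral>\<zeta>. u \<zeta> * of_real (indicator C \<zeta>) \<partial>\<mu>)"
  proof (rule integral_dominated_convergence[where w = "\<lambda>\<zeta>. cmod (u \<zeta>)"])
    show "AE \<zeta> in \<mu>. (\<lambda>k. u \<zeta> * of_real (\<phi> k \<zeta>)) \<longlonglongrightarrow> u \<zeta> * of_real (indicator C \<zeta>)"
    proof (intro AE_I2 tendsto_mult tendsto_const tendsto_of_real)
      fix \<zeta>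
      show "(\<lambda>k. \<phi> k \<zeta>) \<longlonglongrightarrow> indicator C \<zeta>"
      proof (cases "\<zeta> \<in> C")
        case True
        then show ?thesis by (simp add: \<phi>_def)
      next
        case notin: False
        then have pos: "infdist \<zeta> C > 0"
          using infdist_pos_not_in_closed[OF C False] by simp
        obtain N :: nat where N: "1 / infdist \<zeta> C \<le> real N"
          using real_arch_simple by blast
        have "\<phi> k \<zeta> = 0" if "k \<ge> N" for k
        proof -
          have "1 / infdist \<zeta> C \<le> real k"
            using N that by (meson of_nat_mono order_trans)
          then show ?thesis
            using pos by (simp add: \<phi>_def field_simps)
        qed
        then have "(\<lambda>k. \<phi> k \<zeta>) \<longlonglongrightarrow> 0"
          by (intro tendsto_eventually eventually_sequentiallyI[of N])
        then show ?thesis using notin by simp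
      qed
    qed
    have "\<bar>\<phi> k \<zeta>\<bar> \<le> 1" for k \<zeta>
      by (simp add: \<phi>_def infdist_nonneg)
    then show "AE \<zeta> in \<mu>. norm (u \<zeta> * of_real (\<phi> k \<zeta>)) \<le> cmod (u \<zeta>)" for k
      using mult_left_mono[of "\<bar>\<phi> k _\<bar>" 1 "cmod (u _)"] by (auto simp: norm_mult)
  qed (use assms(1) in auto)
  then have "(\<integral>\<zeta>. u \<zeta> * of_real (indicator C \<zeta>) \<partial>\<mu>) = 0"
    by (simp only: fourier_zero_times_continuous[OF assms(1,2) cont] LIMSEQ_const_iff)
  then show ?thesis
    by (simp add: scaleR_conv_of_real mult.commute)
qed simp

text \<open>The sets over which \<open>u\<close> integrates to zero include the closed ones and form a Dynkin system,
  hence they include all Borel sets, and a function with vanishing set integrals is zero almost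
  everywhere.\<close>

theorem fourier_unique:
  assumes u: "integrable \<mu> u" and zero: "\<And>n. (\<integral>\<zeta>. u \<zeta> * \<zeta> powi n \<partial>\<mu>) = 0"
  shows "AE \<zeta> in \<mu>. u \<zeta> = 0"
proof (rule density_zero[OF u])
  note [measurable] = borel_measurable_integrable[OF u]
  have trace: "A \<inter> sphere 0 1 \<in> sets \<mu>" if "A \<in> sets borel" for A :: "complex set"
    unfolding sets_eq sets_restrict_space Int_commute[of A] using that by (rule imageI)
  have int: "integrable \<mu> (\<lambda>\<zeta>. indicator A \<zeta> *\<^sub>R u \<zeta>)" if "A \<in> sets borel" for A
  proof -
    have [measurable]: "(\<lambda>\<zeta>. indicator A \<zeta> :: real) \<in> borel_measurable \<mu>"
      by (rule measurable_of_borel) (rule borel_measurable_indicator[OF that])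
    show ?thesis
    proof (rule Bochner_Integration.integrable_bound[OF u])
      show "(\<lambda>\<zeta>. indicator A \<zeta> *\<^sub>R u \<zeta>) \<in> borel_measurable \<mu>"
        by measurable
    qed (auto simp: indicator_def)
  qed
  have borel: "(\<integral>\<zeta>. indicator A \<zeta> *\<^sub>R u \<zeta> \<partial>\<mu>) = 0" if "A \<in> sets borel" for A
  proof -
    have closed: "Collect closed \<subseteq> Pow (UNIV :: complex set)" "A \<in> sigma_sets UNIV (Collect closed)"
      using that by (simp_all add: borel_eq_closed)
    have closed_Int: "Int_stable (Collect closed :: complex set set)"
      by (auto simp: Int_stable_def)
    from closed show ?thesis
    proof (induction rule: sigma_sets_induct_disjoint[OF closed_Int, consumes 2,
          case_names basic empty compl union])
      case (basic A)
      then show ?case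
        using fourier_zero_on_closed[OF u zero] by auto
    next
      case empty
      then show ?case by simp
    next
      case (compl A)
      then have A: "A \<in> sets borel"
        by (simp add: borel_eq_closed)
      have "(\<integral>\<zeta>. indicator (UNIV - A) \<zeta> *\<^sub>R u \<zeta> \<partial>\<mu>) = (\<integral>\<zeta>. u \<zeta> - indicator A \<zeta> *\<^sub>R u \<zeta> \<partial>\<mu>)"
        by (intro Bochner_Integration.integral_cong) (auto simp: indicator_def)
      also have "\<dots> = (\<integral>\<zeta>. u \<zeta> \<partial>\<mu>) - (\<integral>\<zeta>. indicator A \<zeta> *\<^sub>R u \<zeta> \<partial>\<mu>)"
        by (rule Bochner_Integration.integral_diff[OF u int[OF A]])
      also have "\<dots> = 0"
        using zero[of 0] compl by simp
      finally show ?case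
        .
    next
      case (union A)
      then have A: "A i \<in> sets borel" for i
        by (auto simp: borel_eq_closed)
      have set_int: "(LINT \<zeta>:(B \<inter> sphere 0 1)|\<mu>. u \<zeta>) = (\<integral>\<zeta>. indicator B \<zeta> *\<^sub>R u \<zeta> \<partial>\<mu>)" for B
        unfolding set_lebesgue_integral_def
        by (intro Bochner_Integration.integral_cong) (auto simp: indicator_def space_eq)
      have "(LINT \<zeta>:(\<Union>i. A i \<inter> sphere 0 1)|\<mu>. u \<zeta>) = (\<Sum>i. (LINT \<zeta>:(A i \<inter> sphere 0 1)|\<mu>. u \<zeta>))"
      proof (rule lebesgue_integral_countable_add)
        have "(\<Union>i. A i \<inter> sphere 0 1) \<in> sets \<mu>"
          using trace[OF A] by (intro sets.countable_UN) blast
        then show "set_integrable \<mu> (\<Union>i. A i \<inter> sphere 0 1) u"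
          unfolding set_integrable_def using u by (rule integrable_mult_indicator)
      qed (use union(1) trace[OF A] in \<open>auto simp: disjoint_family_on_def\<close>)
      also have "\<dots> = 0"
        using union by (simp add: set_int)
      also have "(\<Union>i. A i \<inter> sphere 0 1) = (\<Union>i. A i) \<inter> sphere 0 1"
        by auto
      finally show ?case
        by (simp add: set_int)
    qed
  qed
  fix A assume "A \<in> sets \<mu>"
  then obtain B where B: "B \<in> sets borel" "A = sphere 0 1 \<inter> B"
    unfolding sets_eq sets_restrict_space by (elim imageE)
  have "(LINT \<zeta>:A|\<mu>. u \<zeta>) = (\<integral>\<zeta>. indicator B \<zeta> *\<^sub>R u \<zeta> \<partial>\<mu>)"
    unfolding set_lebesgue_integral_def B
    by (intro Bochner_Integration.integral_cong) (auto simp: indicator_def space_eq)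
  then show "(LINT \<zeta>:A|\<mu>. u \<zeta>) = 0"
    using borel[OF B(1)] by simp
qed

lemma L2_eq_AE_I:
  assumes "f \<in> L2 \<mu>" "g \<in> L2 \<mu>"
    and "\<And>n. L2_inner \<mu> f (\<lambda>\<zeta>. \<zeta> powi n) = L2_inner \<mu> g (\<lambda>\<zeta>. \<zeta> powi n)"
  shows "AE \<zeta> in \<mu>. f \<zeta> = g \<zeta>"
proof -
  have "AE \<zeta> in \<mu>. f \<zeta> - g \<zeta> = 0"
  proof (rule fourier_unique[OF L2_integrable[OF L2_diff[OF assms(1,2)]]])
    fix n
    have "(\<integral>\<zeta>. (f \<zeta> - g \<zeta>) * \<zeta> powi n \<partial>\<mu>) = L2_inner \<mu> (\<lambda>\<zeta>. f \<zeta> - g \<zeta>) (\<lambda>\<zeta>. \<zeta> powi (- n))"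
      unfolding L2_inner_def
    proof (rule Bochner_Integration.integral_cong[OF refl])
      fix \<zeta> assume "\<zeta> \<in> space \<mu>"
      then show "(f \<zeta> - g \<zeta>) * \<zeta> powi n = (f \<zeta> - g \<zeta>) * cnj (\<zeta> powi (- n))"
        using cnj_powi[of \<zeta> "- n"] by simp
    qed
    also have "\<dots> = 0"
      using L2_inner_diff_left[OF assms(1,2) L2_powi] assms(3) by simp
    finally show "(\<integral>\<zeta>. (f \<zeta> - g \<zeta>) * \<zeta> powi n \<partial>\<mu>) = 0" .
  qed
  then show ?thesis by simp
qed

end

section \<open>Completeness and the spectral model of a stationary sequence\<close>

context circle_measure
begin

text \<open>Riesz-Fischer: along a subsequence with \<open>\<parallel>f\<^sub>r\<^sub>(\<^sub>k\<^sub>+\<^sub>1\<^sub>) - f\<^sub>r\<^sub>(\<^sub>k\<^sub>)\<parallel> < 2\<^sup>-\<^sup>k\<close> the increments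
  are absolutely summable almost everywhere. Fatou's lemma compares the pointwise limit with
  the original sequence.\<close>

lemma L2_complete:
  assumes f: "\<And>k. f k \<in> L2 \<mu>"
    and cauchy: "\<And>e. e > 0 \<Longrightarrow> \<exists>N. \<forall>m\<ge>N. \<forall>n\<ge>N. (\<integral>\<zeta>. (cmod (f m \<zeta> - f n \<zeta>))\<^sup>2 \<partial>\<mu>) < e"
  obtains g where "g \<in> L2 \<mu>" "(\<lambda>n. \<integral>\<zeta>. (cmod (g \<zeta> - f n \<zeta>))\<^sup>2 \<partial>\<mu>) \<longlonglongrightarrow> 0"
proof -
  note [measurable] = f[THEN L2_measurable]
  have "\<exists>N. \<forall>m\<ge>N. \<forall>n\<ge>N. (\<integral>\<zeta>. (cmod (f m \<zeta> - f n \<zeta>))\<^sup>2 \<partial>\<mu>) < ((1/2) ^ k)\<^sup>2" for k :: nat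
    by (rule cauchy) simp
  then obtain N where N: "\<And>k m n. m \<ge> N k \<Longrightarrow> n \<ge> N k \<Longrightarrow>
      (\<integral>\<zeta>. (cmod (f m \<zeta> - f n \<zeta>))\<^sup>2 \<partial>\<mu>) < ((1/2) ^ k)\<^sup>2"
    by metis
  define r where "r k = k + (\<Sum>i\<le>k. N i)" for k
  have r: "r k \<ge> k" "r k \<ge> N k" "r (Suc k) \<ge> N k" for k
    using member_le_sum[of k "{..k}" N] by (auto simp: r_def)
  define d where "d k \<zeta> = cmod (f (r (Suc k)) \<zeta> - f (r k) \<zeta>)" for k \<zeta>
  have [measurable]: "d k \<in> borel_measurable \<mu>" for k
    unfolding d_def by measurable
  have d_sq: "integrable \<mu> (\<lambda>\<zeta>. (d k \<zeta>)\<^sup>2)" for k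
    unfolding d_def by (rule L2_integrable_square[OF L2_diff[OF f f]])
  have d_int: "integrable \<mu> (d k)" for k
    unfolding d_def by (rule integrable_norm[OF L2_integrable[OF L2_diff[OF f f]]])
  have d_le: "(\<integral>\<zeta>. d k \<zeta> \<partial>\<mu>) \<le> (1/2) ^ k" for k
  proof -
    \<comment> \<open>The weight \<open>a\<close> turns the bound \<open>a\<^sup>2\<close> for the integral of the square into the bound \<open>a\<close> for the
      integral itself.\<close>
    define a :: real where "a = (1/2) ^ k"
    have "a > 0" by (simp add: a_def)
    have "x \<le> (a + x\<^sup>2 / a) / 2" for x
      using sum_squares_bound[of a x] \<open>a > 0\<close> by (simp add: field_simps power2_eq_square)
    then have "(\<integral>\<zeta>. d k \<zeta> \<partial>\<mu>) \<le> (\<integral>\<zeta>. (a + (d k \<zeta>)\<^sup>2 / a) / 2 \<partial>\<mu>)"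
      using d_int d_sq by (intro integral_mono) auto
    also have "\<dots> = (a + (\<integral>\<zeta>. (d k \<zeta>)\<^sup>2 \<partial>\<mu>) / a) / 2"
      using d_sq by (simp add: prob_space)
    also have "\<dots> \<le> (a + a\<^sup>2 / a) / 2"
      using N[OF r(3) r(2), of k] \<open>a > 0\<close>
      by (intro divide_right_mono add_left_mono) (auto simp: d_def a_def)
    also have "\<dots> = a"
      using \<open>a > 0\<close> by (simp add: power2_eq_square)
    finally show ?thesis by (simp add: a_def)
  qed
  have "(\<integral>\<^sup>+\<zeta>. (\<Sum>k. ennreal (d k \<zeta>)) \<partial>\<mu>) = (\<Sum>k. \<integral>\<^sup>+\<zeta>. ennreal (d k \<zeta>) \<partial>\<mu>)"
    by (rule nn_integral_suminf) measurable
  also have "\<dots> = (\<Sum>k. ennreal (\<integral>\<zeta>. d k \<zeta> \<partial>\<mu>))"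
    using d_int by (subst nn_integral_eq_integral) (auto simp: d_def)
  also have "\<dots> \<le> (\<Sum>k. ennreal ((1/2) ^ k))"
    by (intro suminf_le ennreal_leI d_le) auto
  also have "\<dots> = ennreal (\<Sum>k. (1/2) ^ k)"
    by (rule suminf_ennreal2) (auto intro: summable_geometric)
  finally have "(\<integral>\<^sup>+\<zeta>. (\<Sum>k. ennreal (d k \<zeta>)) \<partial>\<mu>) \<noteq> \<infinity>"
    by (auto simp: top_unique)
  then have "AE \<zeta> in \<mu>. (\<Sum>k. ennreal (d k \<zeta>)) \<noteq> \<infinity>"
    by (intro nn_integral_PInf_AE) measurable
  then have lim: "AE \<zeta> in \<mu>. (\<lambda>k. f (r k) \<zeta>) \<longlonglongrightarrow> lim (\<lambda>k. f (r k) \<zeta>)"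
  proof eventually_elim
    case (elim \<zeta>)
    have "summable (\<lambda>k. d k \<zeta>)"
      using elim by (intro summable_suminf_not_top) (auto simp: d_def)
    then have "summable (\<lambda>k. f (r (Suc k)) \<zeta> - f (r k) \<zeta>)"
      unfolding d_def by (rule summable_norm_cancel)
    then have "convergent (\<lambda>n. \<Sum>k<n. f (r (Suc k)) \<zeta> - f (r k) \<zeta>)"
      by (simp add: summable_iff_convergent)
    then have "convergent (\<lambda>n. f (r n) \<zeta> - f (r 0) \<zeta>)"
      by (simp only: sum_lessThan_telescope[of "\<lambda>n. f (r n) \<zeta>"])
    then have "convergent (\<lambda>n. f (r n) \<zeta>)"
      using convergent_add_const_right_iff[of "\<lambda>n. f (r n) \<zeta>" "- f (r 0) \<zeta>"] by simp
    then show ?case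
      by (simp add: convergent_LIMSEQ_iff)
  qed
  define g where "g \<zeta> = lim (\<lambda>k. f (r k) \<zeta>)" for \<zeta>
  have [measurable]: "g \<in> borel_measurable \<mu>"
    unfolding g_def by measurable
  have fatou: "(\<lambda>\<zeta>. g \<zeta> - f n \<zeta>) \<in> L2 \<mu> \<and> (\<integral>\<zeta>. (cmod (g \<zeta> - f n \<zeta>))\<^sup>2 \<partial>\<mu>) \<le> e"
    if M: "\<And>m. m \<ge> M \<Longrightarrow> (\<integral>\<zeta>. (cmod (f m \<zeta> - f n \<zeta>))\<^sup>2 \<partial>\<mu>) < e" and "e \<ge> 0" for M n e
  proof -
    have "(\<integral>\<^sup>+\<zeta>. ennreal ((cmod (g \<zeta> - f n \<zeta>))\<^sup>2) \<partial>\<mu>) =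
        (\<integral>\<^sup>+\<zeta>. liminf (\<lambda>k. ennreal ((cmod (f (r k) \<zeta> - f n \<zeta>))\<^sup>2)) \<partial>\<mu>)"
    proof (rule nn_integral_cong_AE)
      show "AE \<zeta> in \<mu>. ennreal ((cmod (g \<zeta> - f n \<zeta>))\<^sup>2) =
          liminf (\<lambda>k. ennreal ((cmod (f (r k) \<zeta> - f n \<zeta>))\<^sup>2))"
        using lim
      proof eventually_elim
        case (elim \<zeta>)
        then have "(\<lambda>k. ennreal ((cmod (f (r k) \<zeta> - f n \<zeta>))\<^sup>2)) \<longlonglongrightarrow> ennreal ((cmod (g \<zeta> - f n \<zeta>))\<^sup>2)"
          unfolding g_def by (intro tendsto_ennrealI tendsto_intros)
        then show ?case
          by (rule lim_imp_Liminf[OF sequentially_bot, symmetric])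
      qed
    qed
    also have "\<dots> \<le> liminf (\<lambda>k. \<integral>\<^sup>+\<zeta>. ennreal ((cmod (f (r k) \<zeta> - f n \<zeta>))\<^sup>2) \<partial>\<mu>)"
      by (rule nn_integral_liminf) measurable
    also have "\<dots> \<le> limsup (\<lambda>k. \<integral>\<^sup>+\<zeta>. ennreal ((cmod (f (r k) \<zeta> - f n \<zeta>))\<^sup>2) \<partial>\<mu>)"
      by (rule Liminf_le_Limsup) simp
    also have "\<dots> \<le> ennreal e"
    proof (rule Limsup_bounded, rule eventually_sequentiallyI[of M])
      fix k assume "M \<le> k"
      then have "(\<integral>\<zeta>. (cmod (f (r k) \<zeta> - f n \<zeta>))\<^sup>2 \<partial>\<mu>) \<le> e"
        using M[of "r k"] r(1)[of k] by simp
      then show "(\<integral>\<^sup>+\<zeta>. ennreal ((cmod (f (r k) \<zeta> - f n \<zeta>))\<^sup>2) \<partial>\<mu>) \<le> ennreal e"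
        by (subst nn_integral_eq_integral[OF L2_integrable_square[OF L2_diff[OF f f]]])
          (auto intro: ennreal_leI)
    qed
    finally have le: "(\<integral>\<^sup>+\<zeta>. ennreal ((cmod (g \<zeta> - f n \<zeta>))\<^sup>2) \<partial>\<mu>) \<le> ennreal e" .
    have int: "integrable \<mu> (\<lambda>\<zeta>. (cmod (g \<zeta> - f n \<zeta>))\<^sup>2)"
      by (rule integrableI_bounded) (use le in \<open>auto simp: less_top[symmetric] top_unique\<close>)
    moreover have "(\<integral>\<zeta>. (cmod (g \<zeta> - f n \<zeta>))\<^sup>2 \<partial>\<mu>) \<le> e"
      using le \<open>e \<ge> 0\<close> nn_integral_eq_integral[OF int] by (simp add: ennreal_le_iff)
    ultimately show ?thesis
      by (auto intro!: L2_I)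
  qed
  have *: "\<exists>M. \<forall>n\<ge>M. (\<lambda>\<zeta>. g \<zeta> - f n \<zeta>) \<in> L2 \<mu> \<and> (\<integral>\<zeta>. (cmod (g \<zeta> - f n \<zeta>))\<^sup>2 \<partial>\<mu>) \<le> e"
    if "e > 0" for e
    using cauchy[OF that] fatou that by (meson less_imp_le)
  obtain n where "(\<lambda>\<zeta>. g \<zeta> - f n \<zeta>) \<in> L2 \<mu>"
    using *[of 1] by auto
  from L2_add[OF this f[of n]] have "g \<in> L2 \<mu>" by simp
  moreover have "(\<lambda>n. \<integral>\<zeta>. (cmod (g \<zeta> - f n \<zeta>))\<^sup>2 \<partial>\<mu>) \<longlonglongrightarrow> 0"
  proof (rule LIMSEQ_I)
    fix e :: real assume "e > 0"
    then obtain M where "\<forall>n\<ge>M. (\<integral>\<zeta>. (cmod (g \<zeta> - f n \<zeta>))\<^sup>2 \<partial>\<mu>) \<le> e / 2"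
      using *[of "e / 2"] by auto
    then show "\<exists>M. \<forall>n\<ge>M. norm ((\<integral>\<zeta>. (cmod (g \<zeta> - f n \<zeta>))\<^sup>2 \<partial>\<mu>) - 0) < e"
      using \<open>e > 0\<close> by (intro exI[of _ M]) fastforce
  qed
  ultimately show ?thesis
    using that by blast
qed

lemma L2_inner_tendsto:
  assumes "\<And>n. f n \<in> L2 \<mu>" "g \<in> L2 \<mu>" "h \<in> L2 \<mu>"
    and lim: "(\<lambda>n. \<integral>\<zeta>. (cmod (g \<zeta> - f n \<zeta>))\<^sup>2 \<partial>\<mu>) \<longlonglongrightarrow> 0"
  shows "(\<lambda>n. L2_inner \<mu> (f n) h) \<longlonglongrightarrow> L2_inner \<mu> g h"
proof -
  have "(\<lambda>n. (cmod (L2_inner \<mu> (\<lambda>\<zeta>. g \<zeta> - f n \<zeta>) h))\<^sup>2) \<longlonglongrightarrow> 0"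
  proof (rule Lim_null_comparison)
    show "(\<lambda>n. (\<integral>\<zeta>. (cmod (g \<zeta> - f n \<zeta>))\<^sup>2 \<partial>\<mu>) * (\<integral>\<zeta>. (cmod (h \<zeta>))\<^sup>2 \<partial>\<mu>)) \<longlonglongrightarrow> 0"
      using tendsto_mult_left_zero[OF lim] by simp
  qed (use L2_Cauchy_Schwarz[OF L2_diff[OF assms(2,1)] assms(3)] in auto)
  from tendsto_real_sqrt[OF this]
  have "(\<lambda>n. cmod (L2_inner \<mu> g h - L2_inner \<mu> (f n) h)) \<longlonglongrightarrow> 0"
    by (simp add: L2_inner_diff_left assms)
  then have "(\<lambda>n. L2_inner \<mu> g h - L2_inner \<mu> (f n) h) \<longlonglongrightarrow> 0"
    by (rule tendsto_norm_zero_cancel)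
  from tendsto_diff[OF tendsto_const[of "L2_inner \<mu> g h"] this] show ?thesis
    by simp
qed

text \<open>The Kolmogorov isomorphism. A vector \<open>y\<close> and a function \<open>k\<close> correspond if \<open>k\<close> has the
  Fourier coefficients \<open>\<langle>y, e\<^sub>n\<rangle>\<close> and pairs with every other such function as \<open>y\<close> does with
  the corresponding vector. The vectors having a partner form a subspace, which is closed
  because \<open>L\<^sup>2(\<mu>)\<close> is complete and contains every \<open>e\<^sub>n\<close>; as the \<open>e\<^sub>n\<close> are total, it is
  everything. Uniqueness of Fourier coefficients makes the partner unique and linear in \<open>y\<close>;
  the Riesz representation makes the correspondence surjective.\<close>

theorem kolmogorov_isomorphism:
  fixes e :: "int \<Rightarrow> 'b::chilbert_space"
  assumes moments: "\<And>m n. cinner (e m) (e n) = (\<integral>\<zeta>. \<zeta> powi (m - n) \<partial>\<mu>)"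
    and total: "\<And>x. (\<And>n. cinner x (e n) = 0) \<Longrightarrow> x = 0"
  obtains W where "unitary_onto_L2 \<mu> (L2 \<mu>) W" "\<And>n. AE \<zeta> in \<mu>. W (e n) \<zeta> = \<zeta> powi n"
proof -
  define R where "R y k \<longleftrightarrow> k \<in> L2 \<mu> \<and> (\<forall>n. L2_inner \<mu> k (\<lambda>\<zeta>. \<zeta> powi n) = cinner y (e n))" for y k
  define P where "P y k \<longleftrightarrow> R y k \<and> (\<forall>x h. R x h \<longrightarrow> L2_inner \<mu> h k = cinner x y)" for y k
  have P_L2: "P y k \<Longrightarrow> k \<in> L2 \<mu>" for y k
    by (simp add: P_def R_def)
  have P_R: "P y k \<Longrightarrow> R y k" for y k
    by (simp add: P_def)
  have P_inner: "L2_inner \<mu> h k = cinner x y" if "P x h" "P y k" for x y h k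
    using that by (auto simp: P_def)
  have P_e: "P (e n) (\<lambda>\<zeta>. \<zeta> powi n)" for n
  proof -
    have "L2_inner \<mu> (\<lambda>\<zeta>. \<zeta> powi n) (\<lambda>\<zeta>. \<zeta> powi m) = cinner (e n) (e m)" for m
      unfolding L2_inner_def moments
    proof (rule Bochner_Integration.integral_cong[OF refl])
      fix \<zeta> assume "\<zeta> \<in> space \<mu>"
      moreover from this have "\<zeta> \<noteq> 0"
        by (auto simp: space_eq)
      ultimately show "\<zeta> powi n * cnj (\<zeta> powi m) = \<zeta> powi (n - m)"
        by (simp only: cnj_powi diff_conv_add_uminus power_int_add simp_thms)
    qed
    then show ?thesis
      by (auto simp: P_def R_def L2_powi)
  qed
  have R_add: "R (x + y) (\<lambda>\<zeta>. h \<zeta> + k \<zeta>)" if "R x h" "R y k" for x y h k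
    using that by (auto simp: R_def L2_add L2_inner_add_left L2_powi cinner_add_left)
  have R_scale: "R (c *\<^sub>C x) (\<lambda>\<zeta>. c * h \<zeta>)" if "R x h" for c x h
    using that by (auto simp: R_def L2_cmult L2_inner_cmult_left cinner_scaleC_left)
  have P_add: "P (x + y) (\<lambda>\<zeta>. h \<zeta> + k \<zeta>)" if "P x h" "P y k" for x y h k
    unfolding P_def
  proof (intro conjI allI impI)
    fix z l assume "R z l"
    then have "l \<in> L2 \<mu>" "L2_inner \<mu> l h = cinner z x" "L2_inner \<mu> l k = cinner z y"
      using that by (auto simp: P_def R_def)
    then show "L2_inner \<mu> l (\<lambda>\<zeta>. h \<zeta> + k \<zeta>) = cinner z (x + y)"
      using that by (simp add: L2_inner_add_right P_L2[OF that(1)] P_L2[OF that(2)] cinner_add_right)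
  qed (intro R_add P_R that)
  have P_scale: "P (c *\<^sub>C x) (\<lambda>\<zeta>. c * h \<zeta>)" if "P x h" for c x h
    using that by (auto simp: P_def R_scale L2_inner_cmult_right cinner_scaleC_right)
  have P_diff: "P (x - y) (\<lambda>\<zeta>. h \<zeta> - k \<zeta>)" if "P x h" "P y k" for x y h k
  proof -
    have "(- 1 :: complex) *\<^sub>C y = - y"
      using scaleR_eq_scaleC[of "-1" y] by simp
    then show ?thesis
      using P_add[OF that(1) P_scale[OF that(2), of "-1"]] by simp
  qed
  have P_norm: "(\<integral>\<zeta>. (cmod (k \<zeta>))\<^sup>2 \<partial>\<mu>) = (norm y)\<^sup>2" if "P y k" for y k
    using P_inner[OF that that] unfolding L2_inner_self cinner_self of_real_eq_iff .
  have closed: "closed {y. \<exists>k. P y k}"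
    unfolding closed_sequential_limits
  proof (intro allI impI)
    fix y l assume "(\<forall>j. y j \<in> {y. \<exists>k. P y k}) \<and> y \<longlonglongrightarrow> l"
    then have "\<forall>j. \<exists>k. P (y j) k" and lim: "y \<longlonglongrightarrow> l" by auto
    then obtain k where k: "\<And>j. P (y j) (k j)" by metis
    have "Cauchy y"
      using lim by (rule LIMSEQ_imp_Cauchy)
    obtain g where g: "g \<in> L2 \<mu>" "(\<lambda>n. \<integral>\<zeta>. (cmod (g \<zeta> - k n \<zeta>))\<^sup>2 \<partial>\<mu>) \<longlonglongrightarrow> 0"
    proof (rule L2_complete[of k])
      fix \<epsilon> :: real assume "\<epsilon> > 0"
      then obtain N where N: "\<And>m n. m \<ge> N \<Longrightarrow> n \<ge> N \<Longrightarrow> norm (y m - y n) < sqrt \<epsilon>"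
        using CauchyD[OF \<open>Cauchy y\<close>, of "sqrt \<epsilon>"] by auto
      have "(norm (y m - y n))\<^sup>2 < \<epsilon>" if "m \<ge> N" "n \<ge> N" for m n
        using power_strict_mono[OF N[OF that], of 2] \<open>\<epsilon> > 0\<close> by simp
      then show "\<exists>N. \<forall>m\<ge>N. \<forall>n\<ge>N. (\<integral>\<zeta>. (cmod (k m \<zeta> - k n \<zeta>))\<^sup>2 \<partial>\<mu>) < \<epsilon>"
        using P_norm[OF P_diff[OF k k]] by auto
    qed (use P_L2[OF k] in auto)
    have inner_lim: "(\<lambda>n. L2_inner \<mu> (k n) h) \<longlonglongrightarrow> L2_inner \<mu> g h" if "h \<in> L2 \<mu>" for h
      by (rule L2_inner_tendsto[OF P_L2[OF k] g(1) that g(2)])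
    have "L2_inner \<mu> g (\<lambda>\<zeta>. \<zeta> powi n) = cinner l (e n)" for n
    proof (rule LIMSEQ_unique[OF inner_lim[OF L2_powi]])
      have "L2_inner \<mu> (k j) (\<lambda>\<zeta>. \<zeta> powi n) = cinner (y j) (e n)" for j
        using P_R[OF k[of j]] by (simp add: R_def)
      then show "(\<lambda>j. L2_inner \<mu> (k j) (\<lambda>\<zeta>. \<zeta> powi n)) \<longlonglongrightarrow> cinner l (e n)"
        by (simp only:) (intro tendsto_intros lim)
    qed
    moreover have "L2_inner \<mu> h g = cinner x l" if "R x h" for x h
    proof (rule LIMSEQ_unique)
      have "h \<in> L2 \<mu>"
        using that by (simp add: R_def)
      from tendsto_cnj[OF inner_lim[OF this]]
      show "(\<lambda>j. L2_inner \<mu> h (k j)) \<longlonglongrightarrow> L2_inner \<mu> h g"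
        by (simp only: L2_inner_cnj[symmetric])
      have "L2_inner \<mu> h (k j) = cinner x (y j)" for j
        using k[of j] that by (auto simp: P_def)
      then show "(\<lambda>j. L2_inner \<mu> h (k j)) \<longlonglongrightarrow> cinner x l"
        by (simp only:) (intro tendsto_intros lim)
    qed
    ultimately show "l \<in> {y. \<exists>k. P y k}"
      using g(1) by (auto simp: P_def R_def)
  qed
  have "complex_vector.subspace {y. \<exists>k. P y k}"
  proof (rule complex_vector.subspaceI)
    show "0 \<in> {y. \<exists>k. P y k}"
      using P_scale[OF P_e[of 0], of 0] by auto
  qed (auto intro: P_add P_scale)
  have ex: "\<exists>k. P y k" for y
  proof -
    obtain m where m: "\<exists>k. P m k" "\<And>x. (\<exists>k. P x k) \<Longrightarrow> cinner (y - m) x = 0"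
      using orthogonal_decomposition[OF \<open>complex_vector.subspace _\<close> closed, of y] by auto
    have "y - m = 0"
      by (rule total) (use m(2) P_e in blast)
    then show ?thesis
      using m(1) by simp
  qed
  define W where "W y = (SOME k. P y k)" for y
  have W: "P y (W y)" for y
    unfolding W_def by (rule someI_ex[OF ex])
  have unique: "AE \<zeta> in \<mu>. h \<zeta> = k \<zeta>" if "R y h" "R y k" for y h k
    using that by (intro L2_eq_AE_I) (auto simp: R_def)
  have W_add: "AE \<zeta> in \<mu>. W (x + y) \<zeta> = W x \<zeta> + W y \<zeta>" for x y
    by (rule unique[OF P_R[OF W] R_add[OF P_R[OF W] P_R[OF W]]])
  have W_scale: "AE \<zeta> in \<mu>. W (c *\<^sub>C x) \<zeta> = c * W x \<zeta>" for c x
    by (rule unique[OF P_R[OF W] R_scale[OF P_R[OF W]]])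
  have W_e: "AE \<zeta> in \<mu>. W (e n) \<zeta> = \<zeta> powi n" for n
    by (rule unique[OF P_R[OF W] P_R[OF P_e]])
  note W_L2 = P_L2[OF W]
  have W_onto: "\<exists>x. AE \<zeta> in \<mu>. W x \<zeta> = h \<zeta>" if h: "h \<in> L2 \<mu>" for h
  proof -
    have "bounded_clinear (\<lambda>y. L2_inner \<mu> (W y) h)"
    proof (rule bounded_clinearI)
      show "L2_inner \<mu> (W (x + y)) h = L2_inner \<mu> (W x) h + L2_inner \<mu> (W y) h" for x y
        unfolding L2_inner_add_left[OF W_L2 W_L2 h, symmetric]
        by (rule L2_inner_cong_AE[OF W_add]) (auto intro: W_L2 L2_add h)
      show "L2_inner \<mu> (W (c *\<^sub>C x)) h = c *\<^sub>C L2_inner \<mu> (W x) h" for c x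
        unfolding scaleC_complex_def L2_inner_cmult_left[symmetric]
        by (rule L2_inner_cong_AE[OF W_scale]) (auto intro: W_L2 L2_cmult h)
      show "cmod (L2_inner \<mu> (W x) h) \<le> sqrt (\<integral>\<zeta>. (cmod (h \<zeta>))\<^sup>2 \<partial>\<mu>) * norm x" for x
      proof (rule power2_le_imp_le)
        show "(cmod (L2_inner \<mu> (W x) h))\<^sup>2 \<le> (sqrt (\<integral>\<zeta>. (cmod (h \<zeta>))\<^sup>2 \<partial>\<mu>) * norm x)\<^sup>2"
          using L2_Cauchy_Schwarz[OF W_L2 h, of x]
          by (simp add: P_norm[OF W] power_mult_distrib mult.commute)
      qed simp
    qed
    then obtain x where x: "\<And>y. L2_inner \<mu> (W y) h = cinner y x"
      using riesz_representation by blast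
    have "AE \<zeta> in \<mu>. W x \<zeta> = h \<zeta>"
    proof (rule L2_eq_AE_I[OF W_L2 h])
      fix n
      have "L2_inner \<mu> (\<lambda>\<zeta>. \<zeta> powi n) h = L2_inner \<mu> (W (e n)) h"
        by (rule L2_inner_cong_AE) (use W_e in \<open>auto intro: L2_powi W_L2 h simp: eq_commute\<close>)
      also have "\<dots> = cinner (e n) x"
        by (rule x)
      also have "\<dots> = L2_inner \<mu> (\<lambda>\<zeta>. \<zeta> powi n) (W x)"
        by (rule P_inner[OF P_e W, symmetric])
      finally show "L2_inner \<mu> (W x) (\<lambda>\<zeta>. \<zeta> powi n) = L2_inner \<mu> h (\<lambda>\<zeta>. \<zeta> powi n)"
        by (metis L2_inner_cnj)
    qed
    then show ?thesis by blast
  qed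
  have "unitary_onto_L2 \<mu> (L2 \<mu>) W"
    unfolding unitary_onto_L2_def
    using W_L2 W_add W_scale W_onto P_inner[OF W W] by blast
  then show ?thesis
    using that W_e by blast
qed

end

section \<open>Direct sums of Hilbert spaces\<close>

instantiation prod :: (complex_inner, complex_inner) complex_inner
begin

definition scaleC_prod :: "complex \<Rightarrow> 'a \<times> 'b \<Rightarrow> 'a \<times> 'b"
  where "scaleC_prod a x = (a *\<^sub>C fst x, a *\<^sub>C snd x)"

definition cinner_prod :: "'a \<times> 'b \<Rightarrow> 'a \<times> 'b \<Rightarrow> complex"
  where "cinner_prod x y = cinner (fst x) (fst y) + cinner (snd x) (snd y)"

instance
proof
  fix x y :: "'a \<times> 'b"
  show "cinner x y = cnj (cinner y x)"
    unfolding cinner_prod_def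
    by (subst (1 2) cinner_commute) simp
qed (auto simp: scaleC_prod_def cinner_prod_def scaleC_add_right scaleC_add_left scaleC_scaleC
    scaleC_one scaleR_eq_scaleC cinner_simps inner_prod_def inner_eq_Re_cinner prod_eq_iff
    algebra_simps)

end

instance prod :: (chilbert_space, chilbert_space) chilbert_space ..

section \<open>Contractions with rank one defects\<close>

text \<open>The range of the defect operator \<open>D\<close> lies on the line through a unit vector \<open>e\<close>, so
  \<open>D x = \<langle>D x, e\<rangle> e\<close>; self-adjointness turns the coefficient into \<open>\<langle>x, D e\<rangle> = d \<langle>x, e\<rangle>\<close>.\<close>

lemma defect_op_rank_one:
  assumes T: "contraction T" and dim: "complex_vector.dim (defect_space T) = 1"
  obtains e d where "norm e = 1" "d > 0" "\<And>x. defect_op T x = (of_real d * cinner x e) *\<^sub>C e"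
    "defect_space T = range (\<lambda>c. c *\<^sub>C e)"
proof -
  note D = positive_op_defect_op[OF T]
  obtain B where B: "B \<subseteq> defect_space T" "complex_vector.independent B"
      "defect_space T \<subseteq> complex_vector.span B" "card B = complex_vector.dim (defect_space T)"
    using complex_vector.basis_exists by blast
  then obtain b where b: "B = {b}"
    using dim by (auto simp: card_1_singleton_iff)
  then have "b \<noteq> 0"
    using B(2) complex_vector.dependent_zero by blast
  define e where "e = (1 / of_real (norm b)) *\<^sub>C b"
  have "norm e = 1"
    using \<open>b \<noteq> 0\<close> by (simp add: e_def norm_divide)
  have b_e: "b = of_real (norm b) *\<^sub>C e"
    using \<open>b \<noteq> 0\<close> by (simp add: e_def scaleC_scaleC scaleC_one)
  have sub: "\<exists>c. y = c *\<^sub>C e" if "y \<in> defect_space T" for y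
  proof -
    have "y \<in> complex_vector.span {b}"
      using that B(3) b by blast
    then obtain k where "y = k *\<^sub>C b"
      by (auto simp: complex_vector.span_singleton)
    then show ?thesis
      by (subst (asm) b_e) (auto simp: scaleC_scaleC)
  qed
  have D_e: "defect_op T x = cinner (defect_op T x) e *\<^sub>C e" for x
  proof -
    obtain c where c: "defect_op T x = c *\<^sub>C e"
      using sub closure_subset[of "range (defect_op T)"] unfolding defect_space_def by blast
    then show ?thesis
      using \<open>norm e = 1\<close> by (simp add: cinner_simps cinner_self)
  qed
  define d where "d = Re (cinner (defect_op T e) e)"
  have d: "cinner (defect_op T e) e = of_real d" "d \<ge> 0"
    using D by (auto simp: positive_op_def complex_nonneg_Reals_iff d_def complex_eq_iff)
  have D_x: "defect_op T x = (of_real d * cinner x e) *\<^sub>C e" for x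
  proof -
    have "cinner (defect_op T x) e = cinner x (defect_op T e)"
      by (rule positive_op_selfadjoint[OF D])
    also have "\<dots> = of_real d * cinner x e"
      by (subst D_e) (simp add: d cinner_simps)
    finally show ?thesis
      using D_e[of x] by simp
  qed
  have "d \<noteq> 0"
  proof
    assume "d = 0"
    then have "range (defect_op T) = {0}"
      using D_x by auto
    then have "defect_space T = {0}"
      by (simp add: defect_space_def)
    then show False
      using B(1) b \<open>b \<noteq> 0\<close> by blast
  qed
  have "c *\<^sub>C e \<in> defect_space T" for c
  proof -
    have "c *\<^sub>C e = defect_op T ((c / of_real d) *\<^sub>C e)"
      using \<open>norm e = 1\<close> \<open>d \<noteq> 0\<close> by (simp add: D_x cinner_simps cinner_self)
    then show ?thesis
      unfolding defect_space_def using closure_subset[of "range (defect_op T)"] by auto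
  qed
  with sub have "defect_space T = range (\<lambda>c. c *\<^sub>C e)"
    by auto
  moreover have "d > 0"
    using \<open>d \<ge> 0\<close> \<open>d \<noteq> 0\<close> by simp
  ultimately show ?thesis
    using that[OF \<open>norm e = 1\<close> _ D_x] by blast
qed

text \<open>Coordinates for a contraction with rank one defects. The vectors \<open>e\<close> and \<open>e'\<close> identify the
  defect spaces with \<open>\<complex>\<close>, and in these coordinates \<open>-\<tau>\<close> is the value of the characteristic
  function at \<open>0\<close>.\<close>

locale rank_one_contraction =
  fixes T :: "'a::chilbert_space \<Rightarrow> 'a" and e e' :: 'a and d :: real and \<tau> :: complex
  assumes contraction: "contraction T"
    and norm_e: "norm e = 1" and norm_e': "norm e' = 1" and d_pos: "d > 0"
    and defect_op: "defect_op T x = (of_real d * cinner x e) *\<^sub>C e"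
    and defect_op': "defect_op (cadjoint T) x = (of_real d * cinner x e') *\<^sub>C e'"
    and defect_space: "defect_space T = range (\<lambda>c. c *\<^sub>C e)"
    and defect_space': "defect_space (cadjoint T) = range (\<lambda>c. c *\<^sub>C e')"
    and T_e: "T e = \<tau> *\<^sub>C e'" and adjoint_e': "cadjoint T e' = cnj \<tau> *\<^sub>C e"
    and tau: "\<tau> * cnj \<tau> = 1 - (of_real d)\<^sup>2"

text \<open>The intertwining \<open>T (I - T\<^sup>*T) = (I - TT\<^sup>*) T\<close> gives \<open>d\<^sup>2 T e = d'\<^sup>2 \<langle>T e, e'\<rangle> e'\<close>, hence
  \<open>T e = \<tau> e'\<close>; dually \<open>T\<^sup>* e'\<close> is \<open>cnj \<tau>\<close> times \<open>e\<close>. So \<open>T\<^sup>*T e = |\<tau>|\<^sup>2 e\<close> and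
  \<open>TT\<^sup>* e' = |\<tau>|\<^sup>2 e'\<close>, which forces \<open>1 - d\<^sup>2 = |\<tau>|\<^sup>2 = 1 - d'\<^sup>2\<close>: the eigenvalues of the
  two defect operators coincide.\<close>

lemma rank_one_contraction_exists:
  fixes T :: "'a::chilbert_space \<Rightarrow> 'a"
  assumes T: "contraction T" and defects: "rank_one_defects T"
  obtains e e' d \<tau> where "rank_one_contraction T e e' d \<tau>"
proof -
  note T' = contraction_cadjoint[OF T]
  note lin = contraction_bounded_clinear[OF T] and lin' = contraction_bounded_clinear[OF T']
  obtain e d where e: "norm e = 1" "d > 0" "\<And>x. defect_op T x = (of_real d * cinner x e) *\<^sub>C e"
      "defect_space T = range (\<lambda>c. c *\<^sub>C e)"
    using defect_op_rank_one[OF T] defects unfolding rank_one_defects_def by metis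
  obtain e' d' where e': "norm e' = 1" "d' > 0"
      "\<And>x. defect_op (cadjoint T) x = (of_real d' * cinner x e') *\<^sub>C e'"
      "defect_space (cadjoint T) = range (\<lambda>c. c *\<^sub>C e')"
    using defect_op_rank_one[OF T'] defects unfolding rank_one_defects_def by metis
  have ee: "cinner e e = 1" "cinner e' e' = 1"
    using e e' by (simp_all add: cinner_self)
  have sq: "x - cadjoint T (T x) = ((of_real d)\<^sup>2 * cinner x e) *\<^sub>C e" for x
    using defect_op_square[OF T, of x]
    by (simp add: e(3) cinner_simps ee power2_eq_square mult.assoc)
  have sq': "x - T (cadjoint T x) = ((of_real d')\<^sup>2 * cinner x e') *\<^sub>C e'" for x
    using defect_op_square[OF T', of x]
    by (simp add: e'(3) cinner_simps ee power2_eq_square mult.assoc cadjoint_cadjoint[OF T])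
  have "T (e - cadjoint T (T e)) = T e - T (cadjoint T (T e))"
    by (simp add: bounded_clinear_diff[OF lin])
  then have Te: "(of_real d)\<^sup>2 *\<^sub>C T e = ((of_real d')\<^sup>2 * cinner (T e) e') *\<^sub>C e'"
    by (simp add: sq sq' ee bounded_clinear_scaleC[OF lin])
  have "cadjoint T (e' - T (cadjoint T e')) = cadjoint T e' - cadjoint T (T (cadjoint T e'))"
    by (simp add: bounded_clinear_diff[OF lin'])
  then have Te': "(of_real d')\<^sup>2 *\<^sub>C cadjoint T e' = ((of_real d)\<^sup>2 * cinner (cadjoint T e') e) *\<^sub>C e"
    by (simp add: sq sq' ee bounded_clinear_scaleC[OF lin'])
  have divide: "y = (b / a) *\<^sub>C z" if "a *\<^sub>C y = b *\<^sub>C z" "a \<noteq> 0" for a b and y z :: 'a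
  proof -
    have "(1 / a) *\<^sub>C (a *\<^sub>C y) = (1 / a) *\<^sub>C (b *\<^sub>C z)"
      using that(1) by simp
    then show ?thesis
      using that(2) by (simp add: scaleC_scaleC scaleC_one)
  qed
  define \<tau> where "\<tau> = cinner (T e) e'"
  have d0: "complex_of_real d \<noteq> 0" "complex_of_real d' \<noteq> 0"
    using e e' by auto
  obtain c where c: "T e = c *\<^sub>C e'"
    using divide[OF Te] d0 by auto
  then have T_e: "T e = \<tau> *\<^sub>C e'"
    by (simp add: \<tau>_def cinner_simps ee)
  obtain c' where c': "cadjoint T e' = c' *\<^sub>C e"
    using divide[OF Te'] d0 by auto
  have "cinner (cadjoint T e') e = cnj \<tau>"
    unfolding cinner_cadjoint_left[OF lin] \<tau>_def by (rule cinner_commute)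
  with c' have T'_e': "cadjoint T e' = cnj \<tau> *\<^sub>C e"
    by (simp add: cinner_simps ee)
  have tau: "\<tau> * cnj \<tau> = 1 - (of_real d)\<^sup>2"
  proof -
    have "cadjoint T (T e) = (\<tau> * cnj \<tau>) *\<^sub>C e"
      by (simp add: T_e bounded_clinear_scaleC[OF lin'] T'_e' scaleC_scaleC)
    then have "cinner (e - (\<tau> * cnj \<tau>) *\<^sub>C e) e = cinner ((of_real d)\<^sup>2 *\<^sub>C e) e"
      using sq[of e] by (simp add: ee)
    then have "1 - \<tau> * cnj \<tau> = (of_real d)\<^sup>2"
      by (simp add: cinner_simps ee)
    then show ?thesis by (simp add: algebra_simps)
  qed
  have tau': "\<tau> * cnj \<tau> = 1 - (of_real d')\<^sup>2"
  proof -
    have "T (cadjoint T e') = (\<tau> * cnj \<tau>) *\<^sub>C e'"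
      by (simp add: T_e bounded_clinear_scaleC[OF lin] T'_e' scaleC_scaleC mult.commute)
    then have "cinner (e' - (\<tau> * cnj \<tau>) *\<^sub>C e') e' = cinner ((of_real d')\<^sup>2 *\<^sub>C e') e'"
      using sq'[of e'] by (simp add: ee)
    then have "1 - \<tau> * cnj \<tau> = (of_real d')\<^sup>2"
      by (simp add: cinner_simps ee)
    then show ?thesis by (simp add: algebra_simps)
  qed
  have "complex_of_real (d\<^sup>2) = of_real (d'\<^sup>2)"
    using tau tau' by simp
  then have "d = d'"
    unfolding of_real_eq_iff using e(2) e'(2) by simp
  then have "rank_one_contraction T e e' d \<tau>"
    using T e e' T_e T'_e' tau by (unfold_locales) auto
  then show ?thesis
    using that by blast
qed

context rank_one_contraction
begin

lemma bounded_clinear_T: "bounded_clinear T"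
  and bounded_clinear_adjoint: "bounded_clinear (cadjoint T)"
  using contraction contraction_cadjoint contraction_bounded_clinear by auto

lemma cinner_e [simp]: "cinner e e = 1" "cinner e' e' = 1"
  using norm_e norm_e' by (simp_all add: cinner_self)

lemma adjoint_T: "cadjoint T (T x) = x - ((of_real d)\<^sup>2 * cinner x e) *\<^sub>C e"
  using defect_op_square[OF contraction, of x]
  by (simp add: defect_op cinner_simps power2_eq_square mult.assoc algebra_simps)

lemma T_adjoint: "T (cadjoint T x) = x - ((of_real d)\<^sup>2 * cinner x e') *\<^sub>C e'"
  using defect_op_square[OF contraction_cadjoint[OF contraction], of x]
  by (simp add: cadjoint_cadjoint[OF contraction] defect_op' cinner_simps power2_eq_square
      mult.assoc algebra_simps)

lemma cinner_T_e': "cinner (T x) e' = \<tau> * cinner x e"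
  by (simp add: cinner_cadjoint[OF bounded_clinear_T] adjoint_e' cinner_simps)

lemma cinner_adjoint_e: "cinner (cadjoint T x) e = cnj \<tau> * cinner x e'"
  by (simp add: cinner_cadjoint_left[OF bounded_clinear_T] T_e cinner_simps)

lemma cinner_T_T: "cinner (T x) (T y) = cinner x y - (of_real d)\<^sup>2 * (cinner x e * cinner e y)"
  by (simp add: cinner_cadjoint[OF bounded_clinear_T] adjoint_T cinner_simps
      cinner_commute[of e y] mult.commute mult.left_commute)

section \<open>The unitary extension\<close>

text \<open>The Julia operator of \<open>T\<close>: identifying the defect spaces with \<open>\<complex>\<close> by \<open>e\<close> and \<open>e'\<close>, it is
  the block matrix with rows \<open>(T, D\<^sub>T\<^sub>*)\<close> and \<open>(D\<^sub>T, -T\<^sup>*)\<close>.\<close>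

definition julia :: "'a \<times> complex \<Rightarrow> 'a \<times> complex"
  where "julia w = (T (fst w) + (snd w * of_real d) *\<^sub>C e', of_real d * cinner (fst w) e - snd w * cnj \<tau>)"

definition julia_inv :: "'a \<times> complex \<Rightarrow> 'a \<times> complex"
  where "julia_inv w = (cadjoint T (fst w) + (snd w * of_real d) *\<^sub>C e,
    of_real d * cinner (fst w) e' - snd w * \<tau>)"

lemma julia_inv_julia [simp]: "julia_inv (julia w) = w"
proof -
  have "snd w * (of_real d)\<^sup>2 + snd w * (\<tau> * cnj \<tau>) = snd w"
    by (simp add: tau algebra_simps)
  then show ?thesis
    by (simp add: julia_inv_def julia_def prod_eq_iff bounded_clinear_add[OF bounded_clinear_adjoint]
        bounded_clinear_scaleC[OF bounded_clinear_adjoint] adjoint_T adjoint_e' cinner_simps cinner_T_e'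
        scaleC_scaleC complex_vector.scale_left_diff_distrib power2_eq_square algebra_simps)
qed

lemma julia_julia_inv [simp]: "julia (julia_inv w) = w"
proof -
  have "snd w * (of_real d)\<^sup>2 + snd w * (\<tau> * cnj \<tau>) = snd w"
    by (simp add: tau algebra_simps)
  then show ?thesis
    by (simp add: julia_inv_def julia_def prod_eq_iff bounded_clinear_add[OF bounded_clinear_T]
        bounded_clinear_scaleC[OF bounded_clinear_T] T_adjoint T_e cinner_simps cinner_adjoint_e
        scaleC_scaleC complex_vector.scale_left_diff_distrib power2_eq_square algebra_simps)
qed

lemma cinner_julia [simp]: "cinner (julia v) (julia w) = cinner v w"
proof -
  have "snd v * (cnj (snd w) * (of_real d)\<^sup>2) + snd v * (cnj (snd w) * (\<tau> * cnj \<tau>)) = snd v * cnj (snd w)"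
    by (simp add: tau algebra_simps)
  moreover have "cinner e' (T y) = cnj \<tau> * cinner e y" for y
    using arg_cong[OF cinner_T_e'[of y], of cnj] by (simp add: cinner_commute[symmetric])
  moreover have "cnj (cinner y e) = cinner e y" for y
    by (rule cinner_commute[symmetric])
  ultimately show ?thesis
    by (simp add: cinner_prod_def cinner_complex_def julia_def cinner_simps cinner_T_T cinner_T_e'
        power2_eq_square algebra_simps)
qed

lemma julia_add: "julia (v + w) = julia v + julia w"
  by (simp add: julia_def bounded_clinear_add[OF bounded_clinear_T] cinner_simps scaleC_add_left
      algebra_simps)

lemma julia_scaleC: "julia (c *\<^sub>C w) = c *\<^sub>C julia w"
  by (simp add: julia_def scaleC_prod_def bounded_clinear_scaleC[OF bounded_clinear_T] cinner_simps
      scaleC_complex_def scaleC_add_right scaleC_scaleC algebra_simps)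

lemma norm_julia_inv: "norm (julia_inv w) = norm w"
  using norm_eq_of_cinner_eq[OF cinner_julia[of "julia_inv w" "julia_inv w"]] by simp

lemma bounded_clinear_julia_inv: "bounded_clinear julia_inv"
proof (rule bounded_clinearI[where K = 1])
  show "julia_inv (v + w) = julia_inv v + julia_inv w" for v w
    using julia_inv_julia[of "julia_inv v + julia_inv w"] by (simp add: julia_add)
  show "julia_inv (c *\<^sub>C w) = c *\<^sub>C julia_inv w" for c w
    using julia_inv_julia[of "c *\<^sub>C julia_inv w"] by (simp add: julia_scaleC)
qed (simp add: norm_julia_inv)

abbreviation omega :: "'a \<times> complex" where "omega \<equiv> (0, 1)"

lemma cinner_omega: "cinner w omega = snd w"
  by (simp add: cinner_prod_def cinner_complex_def)

definition orbit :: "int \<Rightarrow> 'a \<times> complex"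
  where "orbit n = (if n \<ge> 0 then (julia ^^ nat n) omega else (julia_inv ^^ nat (- n)) omega)"

lemma orbit_0: "orbit 0 = omega"
  by (simp add: orbit_def)

lemma julia_orbit: "julia (orbit n) = orbit (n + 1)"
proof (cases "n \<ge> 0")
  case True
  then have "nat (n + 1) = Suc (nat n)"
    by simp
  then show ?thesis
    using True by (simp add: orbit_def)
next
  case False
  then have "nat (- n) = Suc (nat (- (n + 1)))"
    by simp
  then show ?thesis
    using False by (cases "n = - 1") (simp_all add: orbit_def)
qed

lemma orbit_stationary: "cinner (orbit (m + 1)) (orbit (n + 1)) = cinner (orbit m) (orbit n)"
  by (simp only: julia_orbit[symmetric] cinner_julia)

text \<open>A vector \<open>(x, c)\<close> orthogonal to the orbit has \<open>c = 0\<close>, and the set of such \<open>x\<close> is invariant under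
  \<open>T\<close> and \<open>T\<^sup>*\<close>. On it the second components \<open>d \<langle>x, e\<rangle>\<close> and \<open>d \<langle>x, e'\<rangle>\<close> of the
  images vanish as well, so both defect operators do, and \<open>T\<close> is unitary there.\<close>

lemma orbit_total:
  assumes cnu: "completely_nonunitary T" and w: "\<And>n. cinner w (orbit n) = 0"
  shows "w = 0"
proof -
  define M where "M = {x. \<forall>n. cinner (x, 0) (orbit n) = 0}"
  have shift: "cinner (julia v) (orbit n) = cinner v (orbit (n - 1))" for v n
    by (metis cinner_julia julia_orbit diff_add_cancel)
  have shift_inv: "cinner (julia_inv v) (orbit n) = cinner v (orbit (n + 1))" for v n
    by (metis cinner_julia julia_orbit julia_julia_inv)
  have M: "cinner x e = 0" "T x \<in> M" "cinner x e' = 0" "cadjoint T x \<in> M" if "x \<in> M" for x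
  proof -
    have "cinner (julia (x, 0)) (orbit n) = 0" for n
      using that by (simp add: shift M_def)
    moreover from this[of 0] show "cinner x e = 0"
      using d_pos by (simp add: orbit_0 cinner_omega julia_def)
    ultimately show "T x \<in> M"
      by (simp add: M_def julia_def)
    have "cinner (julia_inv (x, 0)) (orbit n) = 0" for n
      using that by (simp add: shift_inv M_def)
    moreover from this[of 0] show "cinner x e' = 0"
      using d_pos by (simp add: orbit_0 cinner_omega julia_inv_def)
    ultimately show "cadjoint T x \<in> M"
      by (simp add: M_def julia_inv_def)
  qed
  have M_eq: "M = {x. \<forall>n. cinner x (fst (orbit n)) = 0}"
    by (simp add: M_def cinner_prod_def)
  have "complex_vector.subspace M"
    unfolding M_eq by (rule complex_vector.subspaceI) (simp_all add: cinner_simps)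
  moreover have "closed M"
    unfolding M_eq
    by (intro closed_Collect_all closed_Collect_eq continuous_intros)
  ultimately have "reduces M T"
    using M by (auto simp: reduces_def)
  moreover have "unitary_between M M T"
    unfolding unitary_between_def
  proof (intro conjI ballI allI)
    show "cinner (T x) (T y) = cinner x y" if "x \<in> M" "y \<in> M" for x y
      using M(1)[OF that(1)] by (simp add: cinner_T_T)
    show "T ` M = M"
    proof
      show "M \<subseteq> T ` M"
      proof
        fix x assume "x \<in> M"
        then have "x = T (cadjoint T x)"
          using M(3) by (simp add: T_adjoint)
        then show "x \<in> T ` M"
          using M(4)[OF \<open>x \<in> M\<close>] by (rule image_eqI)
      qed
    qed (use M(2) in blast)
  qed (simp_all add: bounded_clinear_add[OF bounded_clinear_T] bounded_clinear_scaleC[OF bounded_clinear_T])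
  ultimately have "M = {0}"
    using cnu by (auto simp: completely_nonunitary_def)
  have "snd w = 0"
    using w[of 0] by (simp add: orbit_0 cinner_omega)
  then have "fst w \<in> M"
    using w by (simp add: M_def cinner_prod_def)
  then show ?thesis
    using \<open>M = {0}\<close> \<open>snd w = 0\<close> by (simp add: prod_eq_iff)
qed

section \<open>The characteristic function\<close>

definition resolvent_e :: "complex \<Rightarrow> 'a"
  where "resolvent_e z = inv (\<lambda>y. y - z *\<^sub>C cadjoint T y) e"

text \<open>The matrix entry of the characteristic function with respect to \<open>e\<close> and \<open>e'\<close>.\<close>

definition scalar_char_fun :: "complex \<Rightarrow> complex"
  where "scalar_char_fun z = - \<tau> + z * (of_real d)\<^sup>2 * cinner (resolvent_e z) e'"

lemma bij_resolvent: "cmod z < 1 \<Longrightarrow> bij (\<lambda>y. y - z *\<^sub>C cadjoint T y)"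
  by (rule bij_one_minus_strict_contraction[OF bounded_clinear_adjoint])
    (rule contraction_norm_le[OF contraction_cadjoint[OF contraction]])

lemma resolvent_e: "cmod z < 1 \<Longrightarrow> resolvent_e z - z *\<^sub>C cadjoint T (resolvent_e z) = e"
  unfolding resolvent_e_def by (rule surj_f_inv_f[OF bij_is_surj[OF bij_resolvent]])

lemma resolvent_eqI:
  assumes "cmod z < 1" "x - z *\<^sub>C cadjoint T x = c *\<^sub>C e"
  shows "x = c *\<^sub>C resolvent_e z"
proof (rule injD[OF bij_is_inj[OF bij_resolvent[OF assms(1)]]])
  have "c *\<^sub>C resolvent_e z - z *\<^sub>C cadjoint T (c *\<^sub>C resolvent_e z) =
      c *\<^sub>C (resolvent_e z - z *\<^sub>C cadjoint T (resolvent_e z))"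
    by (simp add: bounded_clinear_scaleC[OF bounded_clinear_adjoint] scaleC_scaleC mult.commute
        complex_vector.scale_right_diff_distrib)
  then show "x - z *\<^sub>C cadjoint T x = c *\<^sub>C resolvent_e z - z *\<^sub>C cadjoint T (c *\<^sub>C resolvent_e z)"
    using assms by (simp add: resolvent_e)
qed

lemma char_fun_eq:
  assumes "cmod z < 1"
  shows "char_fun T z (c *\<^sub>C e) = (c * scalar_char_fun z) *\<^sub>C e'"
proof -
  have "inv (\<lambda>y. y - z *\<^sub>C cadjoint T y) ((of_real d * c) *\<^sub>C e) = (of_real d * c) *\<^sub>C resolvent_e z"
    by (rule resolvent_eqI[OF assms])
      (rule surj_f_inv_f[OF bij_is_surj[OF bij_resolvent[OF assms]]])
  moreover have "c *\<^sub>C e \<in> defect_space T"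
    unfolding defect_space by (rule rangeI)
  moreover have "- (x *\<^sub>C e') = (- x) *\<^sub>C e'" for x
    by simp
  ultimately show ?thesis
    by (simp add: char_fun_def defect_op defect_op' cinner_simps bounded_clinear_scaleC[OF bounded_clinear_T]
        T_e scaleC_scaleC scalar_char_fun_def scaleC_add_left[symmetric] power2_eq_square algebra_simps
        del: complex_vector.scale_minus_left)
qed

lemma is_scalar_char_funI:
  assumes "\<And>z. cmod z < 1 \<Longrightarrow> f z = scalar_char_fun z"
  shows "is_scalar_char_fun T f"
  unfolding is_scalar_char_fun_def
proof (intro exI conjI ballI)
  show "unitary_between (defect_space T) UNIV (\<lambda>x. cinner x e)"
    unfolding unitary_between_def defect_space
    by (auto simp: cinner_simps scaleC_complex_def cinner_complex_def image_iff)
  show "unitary_between (defect_space (cadjoint T)) UNIV (\<lambda>x. cinner x e')"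
    unfolding unitary_between_def defect_space'
    by (auto simp: cinner_simps scaleC_complex_def cinner_complex_def image_iff)
  fix z :: complex and x assume "z \<in> ball 0 1" "x \<in> defect_space T"
  then show "cinner (char_fun T z x) e' = f z * cinner x e"
    by (auto simp: defect_space char_fun_eq assms cinner_simps)
qed

lemma scalar_char_fun_tendsto: "(scalar_char_fun \<longlongrightarrow> scalar_char_fun 0) (at 0)"
proof (rule LIM_zero_cancel, rule Lim_null_comparison)
  show "((\<lambda>z. cmod z * (2 * d\<^sup>2)) \<longlongrightarrow> 0) (at (0::complex))"
    by (intro tendsto_mult_left_zero tendsto_norm_zero tendsto_ident_at)
  show "\<forall>\<^sub>F z in at 0. norm (scalar_char_fun z - scalar_char_fun 0) \<le> cmod z * (2 * d\<^sup>2)"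
    unfolding eventually_at
  proof (intro exI[of _ "1/2"] conjI ballI impI)
    fix z :: complex assume "z \<noteq> 0 \<and> dist z 0 < 1 / 2"
    then have z: "cmod z < 1 / 2" by simp
    define y where "y = resolvent_e z"
    \<comment> \<open>For \<open>|z| < 1/2\<close> the fixed point equation bounds the resolvent by \<open>2\<close>.\<close>
    have "y = e + z *\<^sub>C cadjoint T y"
      using resolvent_e[of z] z by (simp add: y_def algebra_simps)
    then have "norm y \<le> 1 + cmod z * norm (cadjoint T y)"
      using norm_triangle_ineq[of e "z *\<^sub>C cadjoint T y"] norm_e by simp
    also have "\<dots> \<le> 1 + (1/2) * norm y"
      using z contraction_norm_le[OF contraction_cadjoint[OF contraction], of y]
      by (intro add_left_mono mult_mono) auto
    finally have "norm y \<le> 2" by simp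
    then have "cmod (cinner y e') \<le> 2"
      using cmod_cinner_le[of y e'] norm_e' by simp
    then have "cmod z * d\<^sup>2 * cmod (cinner y e') \<le> cmod z * d\<^sup>2 * 2"
      by (intro mult_left_mono) auto
    then show "norm (scalar_char_fun z - scalar_char_fun 0) \<le> cmod z * (2 * d\<^sup>2)"
      by (simp add: scalar_char_fun_def y_def norm_mult norm_power mult_ac)
  qed simp
qed

text \<open>Solving the first component of the block equation with the resolvent of \<open>T\<^sup>*\<close> leaves the Schur
  complement \<open>1 - z \<phi>(z)\<close> in the second, where \<open>\<phi>\<close> is the scalar characteristic function.\<close>

lemma resolvent_corner:
  assumes z: "cmod z < 1" and y: "y - z *\<^sub>C julia_inv y = omega"
  shows "snd y * (1 - z * scalar_char_fun z) = 1"
proof -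
  define a where "a = snd y"
  have 1: "fst y - z *\<^sub>C (cadjoint T (fst y) + (a * of_real d) *\<^sub>C e) = 0"
    and 2: "a - z * (of_real d * cinner (fst y) e' - a * \<tau>) = 1"
    using arg_cong[OF y, of fst] arg_cong[OF y, of snd]
    by (simp_all add: julia_inv_def scaleC_prod_def scaleC_complex_def a_def)
  from 1 have "fst y - z *\<^sub>C cadjoint T (fst y) = (z * (a * of_real d)) *\<^sub>C e"
    by (simp add: scaleC_add_right scaleC_scaleC algebra_simps)
  then have "fst y = (z * (a * of_real d)) *\<^sub>C resolvent_e z"
    by (rule resolvent_eqI[OF z])
  with 2 show ?thesis
    by (simp add: scalar_char_fun_def a_def[symmetric] cinner_simps power2_eq_square algebra_simps)
qed

section \<open>The spectral model\<close>

text \<open>The spectral theorem for the Julia operator with its cyclic vector \<open>(0, 1)\<close>. The orbit is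
  stationary, so it has a spectral measure and a Kolmogorov isomorphism. This intertwines the
  operator with multiplication by \<open>\<zeta>\<close>, since both shift the Fourier coefficients by one.\<close>

theorem spectral_model:
  assumes cnu: "completely_nonunitary T"
  obtains \<mu> W where "circle_prob_measure \<mu>" "unitary_onto_L2 \<mu> (L2 \<mu>) W"
    "AE \<zeta> in \<mu>. W omega \<zeta> = 1" "\<And>w. AE \<zeta> in \<mu>. W (julia w) \<zeta> = \<zeta> * W w \<zeta>"
proof -
  have "norm (orbit 0) = 1"
    by (simp add: orbit_0)
  then obtain \<mu> where \<mu>: "circle_prob_measure \<mu>" "\<And>n. (\<integral>\<zeta>. \<zeta> powi n \<partial>\<mu>) = cinner (orbit n) (orbit 0)"
    using herglotz_representation[of orbit] orbit_stationary by metis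
  interpret circle_measure \<mu>
    by unfold_locales (rule \<mu>)
  have "cinner (orbit m) (orbit n) = (\<integral>\<zeta>. \<zeta> powi (m - n) \<partial>\<mu>)" for m n
    unfolding \<mu>(2) by (rule stationary_shift) (rule orbit_stationary)
  then obtain W where W: "unitary_onto_L2 \<mu> (L2 \<mu>) W" "\<And>n. AE \<zeta> in \<mu>. W (orbit n) \<zeta> = \<zeta> powi n"
    using kolmogorov_isomorphism[of orbit] orbit_total[OF cnu] by metis
  have W_L2: "W w \<in> L2 \<mu>" and W_inner: "L2_inner \<mu> (W v) (W w) = cinner v w" for v w
    using W(1) unfolding unitary_onto_L2_def by blast+
  have coeff: "L2_inner \<mu> (W w) (\<lambda>\<zeta>. \<zeta> powi n) = cinner w (orbit n)" for w n
    unfolding W_inner[symmetric]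
    by (rule L2_inner_cong_AE) (use W(2)[of n] in \<open>auto intro: W_L2 L2_powi simp: eq_commute\<close>)
  have "AE \<zeta> in \<mu>. W (julia w) \<zeta> = \<zeta> * W w \<zeta>" for w
  proof (rule L2_eq_AE_I[OF W_L2 L2_mult_ident[OF W_L2]])
    fix n
    have "L2_inner \<mu> (W (julia w)) (\<lambda>\<zeta>. \<zeta> powi n) = cinner (julia w) (julia (orbit (n - 1)))"
      by (simp only: coeff julia_orbit diff_add_cancel)
    also have "\<dots> = L2_inner \<mu> (W w) (\<lambda>\<zeta>. \<zeta> powi (n - 1))"
      by (simp only: cinner_julia coeff)
    also have "\<dots> = L2_inner \<mu> (\<lambda>\<zeta>. \<zeta> * W w \<zeta>) (\<lambda>\<zeta>. \<zeta> powi n)"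
      unfolding L2_inner_def
    proof (rule Bochner_Integration.integral_cong[OF refl])
      fix \<zeta> assume \<zeta>: "\<zeta> \<in> space \<mu>"
      then have "\<zeta> \<noteq> 0"
        by (auto simp: space_eq)
      then have "\<zeta> powi (- (n - 1)) = \<zeta> * \<zeta> powi (- n)"
        using power_int_add[of \<zeta> 1 "- n"] by simp
      then show "W w \<zeta> * cnj (\<zeta> powi (n - 1)) = \<zeta> * W w \<zeta> * cnj (\<zeta> powi n)"
        unfolding cnj_powi[OF \<zeta>] by simp
    qed
    finally show "L2_inner \<mu> (W (julia w)) (\<lambda>\<zeta>. \<zeta> powi n) = L2_inner \<mu> (\<lambda>\<zeta>. \<zeta> * W w \<zeta>) (\<lambda>\<zeta>. \<zeta> powi n)" .
  qed
  then show ?thesis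
    using that[OF \<mu>(1) W(1)] W(2)[of 0] by (simp add: orbit_0)
qed

end

locale rank_one_model = rank_one_contraction T e e' d \<tau> + circle_measure \<mu>
  for T :: "'a::chilbert_space \<Rightarrow> 'a" and e e' d \<tau> \<mu> +
  fixes W :: "'a \<times> complex \<Rightarrow> complex \<Rightarrow> complex"
  assumes W: "unitary_onto_L2 \<mu> (L2 \<mu>) W"
    and W_omega: "AE \<zeta> in \<mu>. W omega \<zeta> = 1"
    and W_julia: "AE \<zeta> in \<mu>. W (julia w) \<zeta> = \<zeta> * W w \<zeta>"
begin

lemma W_L2: "W w \<in> L2 \<mu>"
  and W_add: "AE \<zeta> in \<mu>. W (v + w) \<zeta> = W v \<zeta> + W w \<zeta>"
  and W_scaleC: "AE \<zeta> in \<mu>. W (c *\<^sub>C w) \<zeta> = c * W w \<zeta>"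
  and W_inner: "L2_inner \<mu> (W v) (W w) = cinner v w"
  and W_onto: "h \<in> L2 \<mu> \<Longrightarrow> \<exists>w. AE \<zeta> in \<mu>. W w \<zeta> = h \<zeta>"
  using W unfolding unitary_onto_L2_def by blast+

lemma W_inner_const: "L2_inner \<mu> (W w) (\<lambda>_. c) = cnj c * snd w"
proof -
  have "L2_inner \<mu> (W w) (\<lambda>_. c) = L2_inner \<mu> (W w) (\<lambda>\<zeta>. c * W omega \<zeta>)"
    by (rule L2_inner_cong_AE) (use W_omega in \<open>auto intro: W_L2 L2_const L2_cmult\<close>)
  then show ?thesis
    by (simp add: L2_inner_cmult_right W_inner cinner_omega)
qed

text \<open>Applying the Julia operator to the equation for \<open>y\<close> and passing to the model gives
  \<open>(\<zeta> - z) W y = \<zeta>\<close>, so the Herglotz kernel \<open>(\<zeta> + z) / (\<zeta> - z)\<close> is \<open>2 W y - 1\<close>. Integrating against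
  \<open>1 = W (0, 1)\<close> extracts the second component of \<open>y\<close>.\<close>

lemma herglotz_eq:
  assumes z: "cmod z < 1" and y: "y - z *\<^sub>C julia_inv y = omega"
  shows "herglotz \<mu> z = 2 * snd y - 1"
proof -
  have "julia omega = julia (y + (- z) *\<^sub>C julia_inv y)"
    using y by simp
  also have "\<dots> = julia y + (- z) *\<^sub>C y"
    by (simp only: julia_add julia_scaleC julia_julia_inv)
  finally have julia_y: "julia y = julia omega + z *\<^sub>C y"
    by simp
  have "AE \<zeta> in \<mu>. (\<zeta> + z) / (\<zeta> - z) = 2 * W y \<zeta> - 1"
    using W_julia[of y] W_julia[of omega] W_omega W_add[of "julia omega" "z *\<^sub>C y"]
      W_scaleC[of z y] AE_space
  proof eventually_elim
    case (elim \<zeta>)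
    then have "\<zeta> - z \<noteq> 0"
      using z by (auto simp: space_eq)
    have eq: "\<zeta> * W y \<zeta> = \<zeta> + z * W y \<zeta>"
      using elim julia_y by simp
    have "(2 * W y \<zeta> - 1) * (\<zeta> - z) = 2 * (\<zeta> * W y \<zeta>) - 2 * (z * W y \<zeta>) - \<zeta> + z"
      by (simp add: algebra_simps)
    also have "\<dots> = \<zeta> + z"
      unfolding eq by simp
    finally show ?case
      using nonzero_eq_divide_eq[OF \<open>\<zeta> - z \<noteq> 0\<close>] by metis
  qed
  then have "herglotz \<mu> z = (\<integral>\<zeta>. 2 * W y \<zeta> - 1 \<partial>\<mu>)"
    unfolding herglotz_def using W_L2[of y, THEN L2_measurable] by (intro integral_cong_AE) auto
  also have "\<dots> = 2 * (\<integral>\<zeta>. W y \<zeta> \<partial>\<mu>) - 1"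
    using L2_integrable[OF W_L2[of y]] by (simp add: prob_space)
  also have "(\<integral>\<zeta>. W y \<zeta> \<partial>\<mu>) = snd y"
    using W_inner_const[of y 1] by (simp add: L2_inner_def)
  finally show ?thesis .
qed

text \<open>With \<open>\<phi>\<close> for the scalar characteristic function and \<open>a = 1 / (1 - z \<phi>(z))\<close> for the corner entry of
  the resolvent, the Herglotz transform is \<open>F = 2a - 1\<close>, hence \<open>F + 1 = 2a\<close>, \<open>F - 1 = 2 a z \<phi>(z)\<close>, and the Schur quotient is \<open>\<phi>(z)\<close>.\<close>

lemma schur_quotient_eq:
  assumes z: "cmod z < 1" "z \<noteq> 0"
  shows "schur_quotient \<mu> z = scalar_char_fun z"
proof -
  have "surj (\<lambda>w. w - z *\<^sub>C julia_inv w)"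
    by (rule bij_is_surj[OF bij_one_minus_strict_contraction[OF bounded_clinear_julia_inv]])
      (simp_all add: norm_julia_inv z)
  then obtain y where "omega = y - z *\<^sub>C julia_inv y"
    by (rule surjE)
  note y = this[symmetric]
  define a where "a = snd y"
  have a: "a * (1 - z * scalar_char_fun z) = 1"
    unfolding a_def by (rule resolvent_corner[OF z(1) y])
  then have "a \<noteq> 0" by auto
  have "a - 1 = a * (z * scalar_char_fun z)"
    using a by (simp add: algebra_simps)
  moreover have "2 * a - 1 - 1 = 2 * (a - 1)"
    by simp
  ultimately have "2 * a - 1 - 1 = 2 * a * (z * scalar_char_fun z)"
    by (simp only: mult.assoc)
  then show ?thesis
    using z(2) \<open>a \<noteq> 0\<close> by (simp add: schur_quotient_def herglotz_eq[OF z(1) y] a_def[symmetric])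
qed

lemma schur_function_eq:
  assumes z: "cmod z < 1"
  shows "schur_function \<mu> z = scalar_char_fun z"
proof (cases "z = 0")
  case True
  have "eventually (\<lambda>w. scalar_char_fun w = schur_quotient \<mu> w) (at 0)"
    unfolding eventually_at by (intro exI[of _ 1]) (auto simp: schur_quotient_eq)
  then have "(schur_quotient \<mu> \<longlongrightarrow> scalar_char_fun 0) (at 0)"
    by (rule Lim_transform_eventually[OF scalar_char_fun_tendsto])
  then show ?thesis
    using True by (simp add: schur_function_def tendsto_Lim)
qed (simp add: schur_function_def schur_quotient_eq z)

lemma W_minus_constants: "W (x, 0) \<in> L2_minus_constants \<mu>"
  by (simp add: L2_minus_constants_def W_L2 W_inner_const)

text \<open>Any \<open>k\<close> with the defining property of the projection equals \<open>W (T x, 0)\<close> almost everywhere: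
  by \<open>julia (x, 0) = (T x, 0) + (d \<langle>x, e\<rangle>) (0, 1)\<close> the latter differs from \<open>\<zeta> W (x, 0)\<close> by a constant,
  and two projections differ by an element orthogonal to itself.\<close>

lemma compressed_mult_W: "AE \<zeta> in \<mu>. W (T x, 0) \<zeta> = compressed_mult \<mu> (W (x, 0)) \<zeta>"
proof -
  define V where "V = L2_minus_constants \<mu>"
  define g where "g \<zeta> = \<zeta> * W (x, 0) \<zeta>" for \<zeta>
  define proj where "proj k \<longleftrightarrow> k \<in> V \<and> (\<forall>h\<in>V. L2_inner \<mu> (\<lambda>\<zeta>. g \<zeta> - k \<zeta>) h = 0)" for k
  have V_L2: "h \<in> V \<Longrightarrow> h \<in> L2 \<mu>" for h
    by (simp add: V_def L2_minus_constants_def)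
  have g_L2: "g \<in> L2 \<mu>"
    unfolding g_def by (rule L2_mult_ident[OF W_L2])
  define c where "c = of_real d * cinner x e"
  have julia_x: "julia (x, 0) = (T x, 0) + c *\<^sub>C omega"
    by (simp add: julia_def c_def scaleC_prod_def scaleC_complex_def)
  have diff: "AE \<zeta> in \<mu>. g \<zeta> - W (T x, 0) \<zeta> = c"
    using W_julia[of "(x, 0)"] W_omega W_add[of "(T x, 0)" "c *\<^sub>C omega"] W_scaleC[of c omega]
  proof eventually_elim
    case (elim \<zeta>)
    then have "\<zeta> * W (x, 0) \<zeta> = W (T x, 0) \<zeta> + c"
      by (simp add: julia_x)
    then show ?case
      by (simp add: g_def)
  qed
  have "proj (W (T x, 0))"
    unfolding proj_def
  proof (intro conjI ballI)
    show "W (T x, 0) \<in> V"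
      unfolding V_def by (rule W_minus_constants)
    fix h assume h: "h \<in> V"
    have "L2_inner \<mu> (\<lambda>\<zeta>. g \<zeta> - W (T x, 0) \<zeta>) h = L2_inner \<mu> (\<lambda>_. c) h"
      by (rule L2_inner_cong_AE) (use diff in \<open>auto intro: L2_diff g_L2 W_L2 L2_const V_L2 h\<close>)
    also have "\<dots> = cnj (L2_inner \<mu> h (\<lambda>_. c))"
      by (rule L2_inner_cnj)
    also have "\<dots> = 0"
      using h by (simp add: V_def L2_minus_constants_def)
    finally show "L2_inner \<mu> (\<lambda>\<zeta>. g \<zeta> - W (T x, 0) \<zeta>) h = 0" .
  qed
  moreover have "compressed_mult \<mu> (W (x, 0)) = (SOME k. proj k)"
    unfolding compressed_mult_def L2_proj_def proj_def V_def g_def ..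
  ultimately have k: "proj (compressed_mult \<mu> (W (x, 0)))"
    by (simp add: someI_ex[of proj] exI)
  define k where "k = compressed_mult \<mu> (W (x, 0))"
  define l where "l \<zeta> = W (T x, 0) \<zeta> - k \<zeta>" for \<zeta>
  have k_V: "k \<in> V" and p_V: "W (T x, 0) \<in> V"
    using k \<open>proj (W (T x, 0))\<close> by (simp_all add: proj_def k_def)
  have l_eq: "l = (\<lambda>\<zeta>. W (T x, 0) \<zeta> - k \<zeta>)"
    by (simp add: l_def fun_eq_iff)
  have l_L2: "l \<in> L2 \<mu>"
    unfolding l_def by (rule L2_diff[OF W_L2 V_L2[OF k_V]])
  have zero: "L2_inner \<mu> l h = 0" if h: "h \<in> V" for h
  proof -
    have "L2_inner \<mu> (\<lambda>\<zeta>. g \<zeta> - k \<zeta>) h = 0" "L2_inner \<mu> (\<lambda>\<zeta>. g \<zeta> - W (T x, 0) \<zeta>) h = 0"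
      using k \<open>proj (W (T x, 0))\<close> h by (simp_all add: proj_def k_def)
    then show ?thesis
      unfolding l_def
      by (simp add: L2_inner_diff_left g_L2 W_L2 V_L2[OF k_V] V_L2[OF h])
  qed
  have "L2_inner \<mu> l l = L2_inner \<mu> l (W (T x, 0)) - L2_inner \<mu> l k"
    by (subst (2) l_eq) (rule L2_inner_diff_right[OF W_L2 V_L2[OF k_V] l_L2])
  also have "\<dots> = 0"
    using zero k_V p_V by simp
  finally have "AE \<zeta> in \<mu>. l \<zeta> = 0"
    by (rule L2_inner_self_eq_0[OF l_L2])
  then show ?thesis
    by (simp add: l_def k_def)
qed

lemma unitarily_equivalent:
  "unitarily_equivalent_L2 T \<mu> (L2_minus_constants \<mu>) (compressed_mult \<mu>)"
  unfolding unitarily_equivalent_L2_def unitary_onto_L2_def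
proof (intro exI[of _ "\<lambda>x. W (x, 0)"] conjI allI ballI)
  show "AE \<zeta> in \<mu>. W (x + y, 0) \<zeta> = W (x, 0) \<zeta> + W (y, 0) \<zeta>" for x y
    using W_add[of "(x, 0)" "(y, 0)"] by simp
  show "AE \<zeta> in \<mu>. W (c *\<^sub>C x, 0) \<zeta> = c * W (x, 0) \<zeta>" for c x
    using W_scaleC[of c "(x, 0)"] by (simp add: scaleC_prod_def)
  show "L2_inner \<mu> (W (x, 0)) (W (y, 0)) = cinner x y" for x y
    by (simp add: W_inner cinner_prod_def)
  fix h assume h: "h \<in> L2_minus_constants \<mu>"
  then have "h \<in> L2 \<mu>"
    by (simp add: L2_minus_constants_def)
  then obtain w where w: "AE \<zeta> in \<mu>. W w \<zeta> = h \<zeta>"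
    using W_onto by blast
  have "snd w = L2_inner \<mu> (W w) (\<lambda>_. 1)"
    by (simp add: W_inner_const)
  also have "\<dots> = L2_inner \<mu> h (\<lambda>_. 1)"
    by (rule L2_inner_cong_AE[OF w]) (auto intro: W_L2 L2_const \<open>h \<in> L2 \<mu>\<close>)
  also have "\<dots> = 0"
    using h by (simp add: L2_minus_constants_def)
  finally have "w = (fst w, 0)"
    by (simp add: prod_eq_iff)
  then show "\<exists>x. AE \<zeta> in \<mu>. W (x, 0) \<zeta> = h \<zeta>"
    using w by metis
qed (simp_all add: W_minus_constants compressed_mult_W)

end

theorem theorem5p1:
  fixes T :: "'a::chilbert_space \<Rightarrow> 'a"
  assumes "separable_space (euclidean :: 'a topology)"
    and "contraction T"
    and "completely_nonunitary T"
    and "rank_one_defects T"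
  shows "\<exists>\<mu>. circle_prob_measure \<mu> \<and>
    unitarily_equivalent_L2 T \<mu> (L2_minus_constants \<mu>) (compressed_mult \<mu>) \<and>
    is_scalar_char_fun T (schur_function \<mu>)"
proof -
  obtain e e' d \<tau> where "rank_one_contraction T e e' d \<tau>"
    using rank_one_contraction_exists[OF assms(2,4)] .
  then interpret rank_one_contraction T e e' d \<tau> .
  obtain \<mu> W where \<mu>: "circle_prob_measure \<mu>" "unitary_onto_L2 \<mu> (L2 \<mu>) W"
    "AE \<zeta> in \<mu>. W omega \<zeta> = 1" "\<And>w. AE \<zeta> in \<mu>. W (julia w) \<zeta> = \<zeta> * W w \<zeta>"
    by (rule spectral_model[OF assms(3)]) (rule that)
  interpret rank_one_model T e e' d \<tau> \<mu> W
    by unfold_locales (use \<mu> in auto)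
  show ?thesis
    using \<mu>(1) unitarily_equivalent is_scalar_char_funI[OF schur_function_eq] by blast
qed

end
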